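(* Let $N_r,N_t\ge 1$, let $\alpha=J_0(2\pi f_d\tau)$ be the time autocorrelation coefficient (so $\alpha\in[-1,1]$), let $\sigma_{\hat h}^2\ge\sigma_h^2>0$, let $D>0$ and put $d=\frac{D}{N_rN_t}$. Let $\mathbf H_{n-1},\mathbf H_n$ (channel matrices), $\hat{\mathbf H}_{n-1},\hat{\mathbf H}_n$ (channel estimates) and $\bar{\mathbf H}_{n-1}$ (the previous channel quantization matrix, known at both transmitter and receiver) be random $N_r\times N_t$ complex matrices satisfying the Gaussian model described in the context. Define the minimum differential feedback rate $$R=\inf\left\{ I\big(\hat{\mathbf H}_n;\bar{\mathbf H}_n\,\big|\,\bar{\mathbf H}_{n-1}\big)\;:\;\mathbb E\big[\|\hat{\mathbf H}_n-\bar{\mathbf H}_n\|^2\big]\le D\right\},$$ where the infimum is over all random matrices $\bar{\mathbf H}_n$ (i.e. all conditional laws of $\bar{\mathbf H}_n$ given $(\hat{\mathbf H}_n,\bar{\mathbf H}_{n-1})$) satisfying the distortion constraint. Then $$R=N_rN_t\cdot\max\left\{\log_2\left[\alpha^2\left(\frac{\sigma_h^2}{\sigma_{\hat h}^2}\right)^2+\frac{1-\alpha^2}{d}\,\sigma_h^2+\frac{\sigma_{\hat h}^2-\sigma_h^2}{d}\left(1+\alpha^2\frac{\sigma_h^2}{\sigma_{\hat h}^2}\right)\right],\,0\right\}.$$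
   Context: $\mathcal{CN}(0,\sigma^2)$ denotes the circularly symmetric complex Gaussian law with variance $\sigma^2$ (with $\mathcal{CN}(0,0)$ the point mass at $0$). $\|\cdot\|$ is the Frobenius norm, $J_0$ is the zero-order Bessel function of the first kind, $f_d$ is the maximum Doppler frequency and $\tau$ the time interval. $I(\cdot;\cdot|\cdot)$ is conditional mutual information, measured in bits. Model (every matrix is $N_r\times N_t$, and different entry positions are i.i.d.): (1) Time-correlated channel: $\mathbf H_n=\alpha\mathbf H_{n-1}+\sqrt{1-\alpha^2}\,\mathbf W_n$, where $\mathbf H_{n-1}$ and $\mathbf W_n$ have i.i.d. $\mathcal{CN}(0,\sigma_h^2)$ entries and $\mathbf W_n$ is independent of $\mathbf H_{n-1}$. (2) Channel estimation: $\hat{\mathbf H}_m=\mathbf H_m+\mathbf H_{e,m}$ for $m=n-1,n$, where $\mathbf H_{e,m}$ is independent of $\mathbf H_m$ and has i.i.d. $\mathcal{CN}(0,\sigma_{\hat h}^2-\sigma_h^2)$ entries, so that $\hat{\mathbf H}_m$ has i.i.d. $\mathcal{CN}(0,\sigma_{\hat h}^2)$ entries. Put $\mathbf\Psi_{n-1}=\mathbf H_{n-1}-\frac{\sigma_h^2}{\sigma_{\hat h}^2}\hat{\mathbf H}_{n-1}$; its entries are $\mathcal{CN}\big(0,\sigma_h^2(\sigma_{\hat h}^2-\sigma_h^2)/\sigma_{\hat h}^2\big)$. (3) Quantization in the previous block: $\hat{\mathbf H}_{n-1}=\bar{\mathbf H}_{n-1}+\mathbf E_{n-1}$, where $\bar{\mathbf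 H}_{n-1}$ has i.i.d. complex Gaussian entries and $\mathbf E_{n-1}$ is independent of $\bar{\mathbf H}_{n-1}$ with i.i.d. $\mathcal{CN}(0,d)$ entries. (4) $\bar{\mathbf H}_{n-1},\mathbf E_{n-1},\mathbf\Psi_{n-1},\mathbf W_n,\mathbf H_{e,n}$ are mutually independent. *)

theory Defs
  imports "HOL-Probability.Probability"
begin

definition bessel_J0 :: "real \<Rightarrow> real" where
  "bessel_J0 x = (\<Sum>k. (-1) ^ k / (fact k)\<^sup>2 * (x / 2) ^ (2 * k))"


section \<open>Complex Gaussian matrices\<close>

text \<open>The circularly symmetric law with variance \<open>v \<ge> 0\<close>: real and imaginary part are independent,
  centred and of variance \<open>v / 2\<close> each. For \<open>v = 0\<close> this is the point mass at \<open>0\<close>.\<close>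

definition complex_normal :: "real \<Rightarrow> complex measure" where
  "complex_normal v =
     distr (std_normal_distribution \<Otimes>\<^sub>M std_normal_distribution) borel
       (\<lambda>(x, y). complex_of_real (sqrt (v / 2)) * Complex x y)"

text \<open>An \<open>N\<^sub>r \<times> N\<^sub>t\<close> matrix has type \<open>complex ^ 't ^ 'r\<close> with \<open>CARD('r) = N\<^sub>r\<close> and
  \<open>CARD('t) = N\<^sub>t\<close>; the norm of this type is the Frobenius norm.\<close>

definition iid_complex_normal :: "'w measure \<Rightarrow> real \<Rightarrow> ('w \<Rightarrow> complex ^ 't ^ 'r) \<Rightarrow> bool" where
  "iid_complex_normal M v A \<longleftrightarrow>
     prob_space.indep_vars M (\<lambda>_. borel) (\<lambda>(i, j) w. A w $ i $ j) UNIV \<and>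
     (\<forall>i j. distr M borel (\<lambda>w. A w $ i $ j) = complex_normal v)"


section \<open>Conditional mutual information\<close>

text \<open>\<^const>\<open>KL_divergence\<close> is a Bochner integral of a Radon-Nikodym derivative, hence has a meaningless
  value when the derivative does not exist or the integral diverges. For probability measures the
  negative part of the integrand is always integrable, so in both cases the divergence is
  infinite. As in the library, the argument order is reversed: this is \<open>D(N \<parallel> M)\<close>.\<close>

definition KL_divergence_ext :: "real \<Rightarrow> 'a measure \<Rightarrow> 'a measure \<Rightarrow> ereal" where
  "KL_divergence_ext b M N =
     (if absolutely_continuous M N \<and> integrable N (entropy_density b M N)
      then ereal (KL_divergence b M N) else \<infinity>)"

definition is_cond_law ::
  "'w measure \<Rightarrow> 'a measure \<Rightarrow> 'c measure \<Rightarrow> ('w \<Rightarrow> 'a) \<Rightarrow> ('w \<Rightarrow> 'c) \<Rightarrow> ('c \<Rightarrow> 'a measure) \<Rightarrow> bool" where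
  "is_cond_law P S U X Z \<kappa> \<longleftrightarrow>
     \<kappa> \<in> U \<rightarrow>\<^sub>M prob_algebra S \<and>
     (\<forall>A\<in>sets S. \<forall>C\<in>sets U.
        emeasure P {w \<in> space P. X w \<in> A \<and> Z w \<in> C} =
          (\<integral>\<^sup>+z\<in>C. emeasure (\<kappa> z) A \<partial>distr P U Z))"

text \<open>A version of the regular conditional law of \<open>X\<close> given \<open>Z\<close>. On the Euclidean spaces considered
  here it exists and is unique up to null sets of the law of \<open>Z\<close>.\<close>

definition cond_law ::
  "'w measure \<Rightarrow> 'a measure \<Rightarrow> 'c measure \<Rightarrow> ('w \<Rightarrow> 'a) \<Rightarrow> ('w \<Rightarrow> 'c) \<Rightarrow> 'c \<Rightarrow> 'a measure" where
  "cond_law P S U X Z = (SOME \<kappa>. is_cond_law P S U X Z \<kappa>)"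

text \<open>\<open>I(X; Y | Z)\<close> is the divergence of the law of \<open>(X, Y, Z)\<close> from the law under which \<open>Z\<close> keeps its
  distribution and, given \<open>Z\<close>, \<open>X\<close> and \<open>Y\<close> keep their conditional distributions but become
  independent. The library's \<^const>\<open>prob_space.conditional_mutual_information\<close> is built from
  \<^const>\<open>KL_divergence\<close> and shares its problem: for instance \<open>Y = X\<close> with continuous \<open>X\<close> does not
  get the value \<open>\<infinity>\<close>, so an infimum over all \<open>Y\<close> would be meaningless.\<close>

definition cond_product_law ::
  "'w measure \<Rightarrow> 'a measure \<Rightarrow> 'b measure \<Rightarrow> 'c measure \<Rightarrow>
     ('w \<Rightarrow> 'a) \<Rightarrow> ('w \<Rightarrow> 'b) \<Rightarrow> ('w \<Rightarrow> 'c) \<Rightarrow> ('a \<times> 'b \<times> 'c) measure" where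
  "cond_product_law P S T U X Y Z =
     do {
       z \<leftarrow> distr P U Z;
       x \<leftarrow> cond_law P S U X Z z;
       y \<leftarrow> cond_law P T U Y Z z;
       return (S \<Otimes>\<^sub>M T \<Otimes>\<^sub>M U) (x, y, z)
     }"

definition cond_mutual_info ::
  "real \<Rightarrow> 'w measure \<Rightarrow> 'a measure \<Rightarrow> 'b measure \<Rightarrow> 'c measure \<Rightarrow>
     ('w \<Rightarrow> 'a) \<Rightarrow> ('w \<Rightarrow> 'b) \<Rightarrow> ('w \<Rightarrow> 'c) \<Rightarrow> ereal" where
  "cond_mutual_info b P S T U X Y Z =
     KL_divergence_ext b
       (cond_product_law P S T U X Y Z)
       (distr P (S \<Otimes>\<^sub>M T \<Otimes>\<^sub>M U) (\<lambda>w. (X w, Y w, Z w)))"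


section \<open>Minimum feedback rate\<close>

text \<open>The joint law of \<open>(X, Y, Z)\<close> when \<open>(X, Z)\<close> has law \<open>L\<close> and \<open>Y\<close> is drawn from \<open>K (X, Z)\<close>.\<close>

definition quantizer_law ::
  "('a \<times> 'a) measure \<Rightarrow> ('a \<times> 'a \<Rightarrow> 'a measure) \<Rightarrow> ('a::euclidean_space \<times> 'a \<times> 'a) measure" where
  "quantizer_law L K =
     do {
       (x, z) \<leftarrow> L;
       y \<leftarrow> K (x, z);
       return (borel \<Otimes>\<^sub>M borel \<Otimes>\<^sub>M borel) (x, y, z)
     }"

definition min_feedback_rate ::
  "'w measure \<Rightarrow> ('w \<Rightarrow> 'a::euclidean_space) \<Rightarrow> ('w \<Rightarrow> 'a) \<Rightarrow> real \<Rightarrow> ereal" where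
  "min_feedback_rate M X Z D =
     (INF K \<in> {K \<in> borel \<Otimes>\<^sub>M borel \<rightarrow>\<^sub>M prob_algebra borel.
          (\<integral>\<^sup>+(x, y, z). ennreal ((norm (x - y))\<^sup>2)
             \<partial>quantizer_law (distr M (borel \<Otimes>\<^sub>M borel) (\<lambda>w. (X w, Z w))) K) \<le> ennreal D}.
        cond_mutual_info 2 (quantizer_law (distr M (borel \<Otimes>\<^sub>M borel) (\<lambda>w. (X w, Z w))) K)
          borel borel borel (\<lambda>(x, y, z). x) (\<lambda>(x, y, z). y) (\<lambda>(x, y, z). z))"

end

theory Submission
  imports Defs
begin

text \<open>The source given the side information \<open>z\<close> is \<open>c z + u\<close> with \<open>u\<close> Gaussian of variance \<open>v\<close> per
  entry and independent of \<open>z\<close>. For the converse, the divergence of a joint law \<open>P\<close> from the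
  conditionally independent law \<open>Q\<close> is at least \<open>\<integral> f dP\<close> whenever \<open>\<integral> e\<^sup>f dQ \<le> 1\<close>; take for \<open>e\<^sup>f\<close> the
  ratio of the Gaussian density of \<open>x - y\<close> with variance \<open>d\<close> to that of \<open>x - c z\<close> with variance \<open>v\<close>.
  If \<open>d < v\<close>, the channel for which \<open>x - y\<close> is Gaussian with variance \<open>d\<close> and independent of
  \<open>(y, z)\<close> has \<open>P = e\<^sup>f Q\<close>, and equality holds; if \<open>d \<ge> v\<close>, then \<open>y = c z\<close> meets the distortion
  constraint with no information at all.\<close>

section \<open>Gaussian measures on Euclidean spaces\<close>

text \<open>An arbitrary quantizer may produce a joint law without a density, so the converse avoids
  differential entropies: one test function f serves all quantizers, and its mean depends on the
  quantizer only through the mean of |x - y|^2, because |x - c z|^2 has the same mean for each of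
  them. It is admissible because x and y are independent given z under Q: for fixed y and z the
  source density cancels in e^f and a Gaussian density in x remains.

  The definition of conditional mutual information selects conditional laws by a choice operator, so
  they are known only up to null sets; uniqueness of regular conditional laws allows explicit
  kernels in their place.

  With \<rho> the ratio of the channel variance to the estimate variance, eliminating the channels
  gives \<open>Hhat1\<close> = \<alpha>\<rho> \<open>Hbar0\<close> + (\<alpha>\<rho>
  \<open>E0\<close> + \<alpha> \<open>Psi0\<close> +
  \<open>sqrt (1 - \<alpha>\<^sup>2) *\<^sub>R W1\<close> + \<open>He1\<close>). Hence c =
  \<alpha>\<rho>, v is the variance of the bracket per complex entry, and v / d is the argument of
  the logarithm. The Bessel bound enters through the square root.\<close>

definition gauss_density :: "real \<Rightarrow> 'a::euclidean_space \<Rightarrow> real" where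
  "gauss_density v x = exp (- (norm x)\<^sup>2 / v) / sqrt (pi * v) ^ DIM('a)"

text \<open>Each real coordinate has variance \<open>v / 2\<close>, so that on complex spaces \<open>v\<close> is the variance of a
  complex entry.\<close>

definition gauss :: "real \<Rightarrow> 'a::euclidean_space measure" where
  "gauss v = (if v = 0 then return borel 0 else density lborel (\<lambda>x. ennreal (gauss_density v x)))"

lemma gauss_density_measurable [measurable]: "gauss_density v \<in> borel_measurable borel"
  unfolding gauss_density_def by measurable

lemma gauss_density_pos: "v > 0 \<Longrightarrow> gauss_density v x > 0"
  by (simp add: gauss_density_def)

lemma gauss_density_nonneg: "v > 0 \<Longrightarrow> gauss_density v x \<ge> 0"
  using gauss_density_pos by (rule less_imp_le)

text \<open>The squared norm splits along the orthonormal basis. This product form is what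
  \<open>nn_integral_lborel_prod\<close> turns into one-dimensional normal integrals, with standard
  deviation \<open>sqrt (v / 2)\<close> in each real coordinate.\<close>

lemma gauss_density_eq_prod:
  fixes x :: "'a::euclidean_space"
  assumes "v > 0"
  shows "gauss_density v x = (\<Prod>b\<in>Basis. normal_density 0 (sqrt (v / 2)) (x \<bullet> b))"
proof -
  have "(\<Prod>b\<in>Basis. normal_density 0 (sqrt (v / 2)) (x \<bullet> b))
      = (\<Prod>b\<in>(Basis::'a set). exp (- (x \<bullet> b)\<^sup>2 / v) / sqrt (pi * v))"
    using assms by (intro prod.cong) (auto simp: normal_density_def field_simps)
  also have "\<dots> = exp (\<Sum>b\<in>(Basis::'a set). - (x \<bullet> b)\<^sup>2 / v) / sqrt (pi * v) ^ DIM('a)"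
    by (simp add: prod_dividef exp_sum)
  also have "(\<Sum>b\<in>(Basis::'a set). - (x \<bullet> b)\<^sup>2 / v) = - (norm x)\<^sup>2 / v"
    unfolding power2_norm_eq_inner euclidean_inner[of x x]
    by (simp add: sum_negf sum_divide_distrib power2_eq_square)
  finally show ?thesis by (simp add: gauss_density_def)
qed

lemma nn_integral_normal_density: "\<sigma> > 0 \<Longrightarrow> (\<integral>\<^sup>+x. ennreal (normal_density \<mu> \<sigma> x) \<partial>lborel) = 1"
  by (subst nn_integral_eq_integral) auto

lemma nn_integral_gauss_density:
  assumes "v > 0"
  shows "(\<integral>\<^sup>+x. ennreal (gauss_density v x) \<partial>(lborel::'a::euclidean_space measure)) = 1"
proof -
  have "(\<integral>\<^sup>+x. ennreal (gauss_density v x) \<partial>(lborel::'a::euclidean_space measure))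
      = (\<integral>\<^sup>+x. (\<Prod>b\<in>Basis. ennreal (normal_density 0 (sqrt (v / 2)) (x \<bullet> b))) \<partial>(lborel::'a::euclidean_space measure))"
    using assms by (simp add: gauss_density_eq_prod prod_ennreal)
  also have "\<dots> = 1"
    using assms by (subst nn_integral_lborel_prod) (auto simp: nn_integral_normal_density)
  finally show ?thesis .
qed

lemma sets_gauss [simp, measurable_cong]: "sets (gauss v) = sets borel"
  by (simp add: gauss_def)

lemma space_gauss [simp]: "space (gauss v) = UNIV"
  by (simp add: gauss_def)

lemma prob_space_gauss:
  assumes "v \<ge> 0"
  shows "prob_space (gauss v)"
proof (cases "v = 0")
  case True
  then show ?thesis by (simp add: gauss_def prob_space_return)
next
  case False
  with assms have "v > 0" by simp
  then show ?thesis
    by (intro prob_spaceI) (simp add: gauss_def emeasure_density nn_integral_gauss_density)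
qed

lemma nn_integral_lborel_shift:
  fixes f :: "'a::euclidean_space \<Rightarrow> ennreal"
  assumes [measurable]: "f \<in> borel_measurable borel"
  shows "(\<integral>\<^sup>+x. f (m + x) \<partial>lborel) = (\<integral>\<^sup>+x. f x \<partial>lborel)"
proof -
  have "(\<integral>\<^sup>+x. f x \<partial>lborel) = (\<integral>\<^sup>+x. f x \<partial>distr lborel borel ((+) m))"
    by (simp add: lborel_distr_plus)
  also have "\<dots> = (\<integral>\<^sup>+x. f (m + x) \<partial>lborel)"
    by (subst nn_integral_distr) auto
  finally show ?thesis by simp
qed

lemma nn_integral_gauss_shift:
  fixes f :: "'a::euclidean_space \<Rightarrow> ennreal"
  assumes [measurable]: "f \<in> borel_measurable borel" and "v > 0"
  shows "(\<integral>\<^sup>+u. f (m + u) \<partial>gauss v) = (\<integral>\<^sup>+x. ennreal (gauss_density v (x - m)) * f x \<partial>lborel)"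
proof -
  have "(\<integral>\<^sup>+u. f (m + u) \<partial>gauss v) = (\<integral>\<^sup>+u. ennreal (gauss_density v (m + u - m)) * f (m + u) \<partial>lborel)"
    using assms by (simp add: gauss_def nn_integral_density)
  also have "\<dots> = (\<integral>\<^sup>+x. ennreal (gauss_density v (x - m)) * f x \<partial>lborel)"
    by (rule nn_integral_lborel_shift[where f = "\<lambda>x. ennreal (gauss_density v (x - m)) * f x"]) simp
  finally show ?thesis .
qed

lemma nn_integral_gauss:
  fixes f :: "'a::euclidean_space \<Rightarrow> ennreal"
  assumes "f \<in> borel_measurable borel" "v > 0"
  shows "(\<integral>\<^sup>+u. f u \<partial>gauss v) = (\<integral>\<^sup>+x. ennreal (gauss_density v x) * f x \<partial>lborel)"
  using nn_integral_gauss_shift[OF assms, of 0] by simp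

lemma nn_integral_gauss_density_shift:
  assumes "v > 0"
  shows "(\<integral>\<^sup>+x. ennreal (gauss_density v (x - m)) \<partial>(lborel::'a::euclidean_space measure)) = 1"
proof -
  have "emeasure (gauss v :: 'a measure) UNIV = 1"
    using assms prob_space.emeasure_space_1[OF prob_space_gauss[of v, where 'a = 'a]] by simp
  then show ?thesis
    using nn_integral_gauss_shift[of "\<lambda>_. 1" v m] assms by simp
qed

text \<open>Both sides are the joint density of \<open>(X, X + Y)\<close> for independent \<open>X \<sim> gauss a\<close> and
  \<open>Y \<sim> gauss b\<close>, factored in the two possible orders.\<close>

lemma gauss_density_bayes:
  fixes x y :: "'a::euclidean_space"
  assumes a: "a > 0" and b: "b > 0"
  shows "gauss_density a x * gauss_density b (y - x)
    = gauss_density (a + b) y * gauss_density (a * b / (a + b)) (x - (a / (a + b)) *\<^sub>R y)"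
proof -
  let ?k = "a / (a + b)" and ?s = "a * b / (a + b)"
  have ab: "a + b > 0" using a b by simp
  have norm_diff: "(norm (u - w))\<^sup>2 = (norm u)\<^sup>2 - 2 * (u \<bullet> w) + (norm w)\<^sup>2" for u w :: 'a
    by (simp add: power2_norm_eq_inner inner_diff inner_commute)
  have alg: "X / a + (Y - 2 * I + X) / b = Y / (a + b) + (X - 2 * (?k * I) + ?k\<^sup>2 * Y) / ?s"
    for X Y I :: real
  proof -
    have 1: "(X - 2 * (?k * I) + ?k\<^sup>2 * Y) / ?s = X * (a + b) / (a * b) - 2 * I / b + a / (b * (a + b)) * Y"
    proof -
      define S where "S = a + b"
      have "S > 0" using ab S_def by simp
      then show ?thesis
        unfolding S_def[symmetric] using a b by (simp add: divide_simps power2_eq_square)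
    qed
    have 2: "X * (a + b) / (a * b) = X / a + X / b"
      using a b by (simp add: field_simps)
    have 3: "a / (b * (a + b)) * Y + Y / (a + b) = Y / b"
      using a b ab by (simp add: divide_simps) (simp add: algebra_simps)
    show ?thesis unfolding 1 2 using 3 by (simp add: add_divide_distrib diff_divide_distrib)
  qed
  have "(norm x)\<^sup>2 / a + (norm (y - x))\<^sup>2 / b = (norm y)\<^sup>2 / (a + b) + (norm (x - ?k *\<^sub>R y))\<^sup>2 / ?s"
    using alg[of "(norm x)\<^sup>2" "(norm y)\<^sup>2" "x \<bullet> y"]
    by (simp add: norm_diff power_mult_distrib power_divide inner_commute)
  hence e: "exp (- (norm x)\<^sup>2 / a) * exp (- (norm (y - x))\<^sup>2 / b)
      = exp (- (norm y)\<^sup>2 / (a + b)) * exp (- (norm (x - ?k *\<^sub>R y))\<^sup>2 / ?s)"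
    unfolding mult_exp_exp by simp
  have s: "sqrt (pi * a) * sqrt (pi * b) = sqrt (pi * (a + b)) * sqrt (pi * ?s)"
    unfolding real_sqrt_mult[symmetric] using ab by simp
  show ?thesis
    unfolding gauss_density_def times_divide_times_eq e
    by (simp only: power_mult_distrib[symmetric] s)
qed

section \<open>Scalings and sums of independent Gaussian vectors\<close>

lemma gauss_scale:
  assumes "v \<ge> 0"
  shows "distr (gauss v) borel (\<lambda>x::'a::euclidean_space. c *\<^sub>R x) = gauss (c\<^sup>2 * v)"
proof (cases "v = 0 \<or> c = 0")
  case True
  then show ?thesis
  proof
    assume "v = 0"
    then show ?thesis by (simp add: gauss_def distr_return)
  next
    assume "c = 0"
    then show ?thesis
      using prob_space.distr_const[OF prob_space_gauss[OF assms], of 0 borel] by (simp add: gauss_def)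
  qed
next
  case False
  with assms have v: "v > 0" and c: "c \<noteq> 0" by auto
  \<comment> \<open>The summand 0 brings the scaling into the affine form of
    \<open>lborel_affine\<close>, which supplies the Jacobian
    \<open>\<bar>c\<bar> ^ DIM('a)\<close>.\<close>
  let ?T = "\<lambda>x::'a. 0 + c *\<^sub>R x"
  let ?g = "\<lambda>x::'a. ennreal (gauss_density (c\<^sup>2 * v) x)"
  have e: "\<bar>c\<bar> ^ DIM('a) * gauss_density (c\<^sup>2 * v) (c *\<^sub>R x) = gauss_density v x" for x :: 'a
  proof -
    have "sqrt (pi * (c\<^sup>2 * v)) = \<bar>c\<bar> * sqrt (pi * v)"
      by (simp add: real_sqrt_mult)
    then show ?thesis
      using c by (simp add: gauss_density_def power_mult_distrib)
  qed
  have "gauss (c\<^sup>2 * v) = density lborel ?g"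
    using v c by (simp add: gauss_def)
  also have "\<dots> = density (density (distr lborel borel ?T) (\<lambda>_. \<bar>c\<bar> ^ DIM('a))) ?g"
    using lborel_affine[OF c, of "0::'a"] by simp
  also have "\<dots> = density (distr lborel borel ?T) (\<lambda>x. ennreal (\<bar>c\<bar> ^ DIM('a)) * ?g x)"
    by (subst density_density_eq) auto
  also have "\<dots> = distr (density lborel (\<lambda>x. ennreal (\<bar>c\<bar> ^ DIM('a)) * ?g (?T x))) borel ?T"
    by (subst density_distr) auto
  also have "(\<lambda>x. ennreal (\<bar>c\<bar> ^ DIM('a)) * ?g (?T x)) = (\<lambda>x. ennreal (gauss_density v x))"
    by (simp add: ennreal_mult'[symmetric] e)
  finally show ?thesis using v by (simp add: gauss_def)
qed

text \<open>Bayes' factorization pulls the density of the sum out in front; what is left in x is a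
  shifted Gaussian density of mass 1.\<close>

lemma nn_integral_gauss_gauss_shift:
  fixes f :: "'a::euclidean_space \<Rightarrow> ennreal"
  assumes [measurable]: "f \<in> borel_measurable borel" and a: "a > 0" and b: "b > 0"
  shows "(\<integral>\<^sup>+x. (\<integral>\<^sup>+y. f (x + y) \<partial>gauss b) \<partial>gauss a) = (\<integral>\<^sup>+y. f y \<partial>gauss (a + b))"
proof -
  let ?g = "\<lambda>v x::'a. ennreal (gauss_density v x)"
  have ab: "a + b > 0" "a * b / (a + b) > 0" using a b by auto
  have "(\<integral>\<^sup>+x. (\<integral>\<^sup>+y. f (x + y) \<partial>gauss b) \<partial>gauss a)
      = (\<integral>\<^sup>+x. ?g a x * (\<integral>\<^sup>+y. ?g b (y - x) * f y \<partial>lborel) \<partial>lborel)"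
    using a b by (simp add: nn_integral_gauss_shift nn_integral_gauss)
  also have "\<dots> = (\<integral>\<^sup>+x. (\<integral>\<^sup>+y. ?g a x * ?g b (y - x) * f y \<partial>lborel) \<partial>lborel)"
    by (simp add: nn_integral_cmult[symmetric] mult.assoc)
  also have "\<dots> = (\<integral>\<^sup>+x. (\<integral>\<^sup>+y. ?g (a + b) y * ?g (a * b / (a + b)) (x - (a / (a + b)) *\<^sub>R y) * f y \<partial>lborel) \<partial>lborel)"
    using a b by (simp add: ennreal_mult[symmetric] gauss_density_nonneg gauss_density_bayes)
  also have "\<dots> = (\<integral>\<^sup>+y. (\<integral>\<^sup>+x. ?g (a + b) y * ?g (a * b / (a + b)) (x - (a / (a + b)) *\<^sub>R y) * f y \<partial>lborel) \<partial>lborel)"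
    by (rule lborel_pair.Fubini') (simp add: case_prod_unfold)
  also have "\<dots> = (\<integral>\<^sup>+y. ?g (a + b) y * f y * (\<integral>\<^sup>+x. ?g (a * b / (a + b)) (x - (a / (a + b)) *\<^sub>R y) \<partial>lborel) \<partial>lborel)"
    by (simp add: nn_integral_cmult[symmetric] mult_ac)
  also have "\<dots> = (\<integral>\<^sup>+y. f y \<partial>gauss (a + b))"
    using ab by (simp add: nn_integral_gauss_density_shift nn_integral_gauss)
  finally show ?thesis .
qed

text \<open>Zero variances do occur: perfect estimation makes the estimation error and
  \<open>Psi0\<close> vanish. A centred Gaussian of variance 0 is almost surely 0, so the sum then
  has the law of the other summand; the positive case is the convolution above.\<close>

lemma (in prob_space) distr_add_gauss:
  fixes X Y :: "'a \<Rightarrow> 'b::euclidean_space"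
  assumes ind: "indep_var borel X borel Y"
    and X: "distr M borel X = gauss a" and Y: "distr M borel Y = gauss b"
    and a: "a \<ge> 0" and b: "b \<ge> 0"
  shows "distr M borel (\<lambda>w. X w + Y w) = gauss (a + b)"
proof -
  have [measurable]: "X \<in> borel_measurable M" "Y \<in> borel_measurable M"
    using ind indep_var_rv1 indep_var_rv2 by blast+
  interpret a: prob_space "gauss a :: 'b measure" by (rule prob_space_gauss[OF a])
  interpret b: prob_space "gauss b :: 'b measure" by (rule prob_space_gauss[OF b])
  have zero: "AE w in M. V w = 0"
    if "distr M borel V = gauss 0" and [measurable]: "V \<in> borel_measurable M" for V :: "'a \<Rightarrow> 'b"
  proof -
    have g0: "gauss 0 = (return borel 0 :: 'b measure)" by (simp add: gauss_def)
    have "AE x in distr M borel V. x = 0"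
      unfolding that(1) g0 by (subst AE_return) auto
    then show ?thesis by (simp add: AE_distr_iff)
  qed
  have joint: "distr M (borel \<Otimes>\<^sub>M borel) (\<lambda>w. (X w, Y w)) = gauss a \<Otimes>\<^sub>M gauss b"
    using ind unfolding indep_var_distribution_eq X Y by simp
  consider "a = 0" | "b = 0" | "a > 0" "b > 0" using a b by fastforce
  then show ?thesis
  proof cases
    case 1
    then have "distr M borel (\<lambda>w. X w + Y w) = distr M borel Y"
      using zero[of X] X by (intro distr_cong_AE) auto
    then show ?thesis using Y 1 by simp
  next
    case 2
    then have "distr M borel (\<lambda>w. X w + Y w) = distr M borel X"
      using zero[of Y] Y by (intro distr_cong_AE) auto
    then show ?thesis using X 2 by simp
  next
    case 3
    show ?thesis
    proof (rule measure_eqI)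
      fix S assume "S \<in> sets (distr M borel (\<lambda>w. X w + Y w))"
      then have [measurable]: "S \<in> sets borel" by simp
      have "emeasure (distr M borel (\<lambda>w. X w + Y w)) S = (\<integral>\<^sup>+w. indicator S (X w + Y w) \<partial>M)"
        by (simp add: nn_integral_indicator[symmetric] nn_integral_distr del: nn_integral_indicator)
      also have "\<dots> = (\<integral>\<^sup>+p. indicator S (fst p + snd p) \<partial>distr M (borel \<Otimes>\<^sub>M borel) (\<lambda>w. (X w, Y w)))"
        by (subst nn_integral_distr) auto
      also have "\<dots> = (\<integral>\<^sup>+x. (\<integral>\<^sup>+y. indicator S (x + y) \<partial>gauss b) \<partial>gauss a)"
        unfolding joint by (subst b.nn_integral_fst[symmetric]) auto
      also have "\<dots> = emeasure (gauss (a + b)) S"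
        using 3 by (subst nn_integral_gauss_gauss_shift) auto
      finally show "emeasure (distr M borel (\<lambda>w. X w + Y w)) S = emeasure (gauss (a + b)) S" .
    qed simp
  qed
qed

text \<open>Disjoint groups of an independent family are independent, and so are functions of them.
  Both the induction for sums of Gaussians and the splitting of the new estimate into side
  information and innovation rest on this.\<close>

lemma (in prob_space) indep_var_scaled_sum:
  fixes X :: "'i \<Rightarrow> 'a \<Rightarrow> 'b::euclidean_space"
  assumes "finite I" "i \<notin> I" and ind: "indep_vars (\<lambda>_. borel) X (insert i I)"
  shows "indep_var borel (\<lambda>w. r *\<^sub>R X i w) borel (\<lambda>w. \<Sum>k\<in>I. c k *\<^sub>R X k w)"
proof -
  have "indep_var borel ((\<lambda>f. r *\<^sub>R f i) \<circ> (\<lambda>w. restrict (\<lambda>k. X k w) {i}))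
      borel ((\<lambda>f. \<Sum>k\<in>I. c k *\<^sub>R f k) \<circ> (\<lambda>w. restrict (\<lambda>k. X k w) I))"
    using assms(1,2) by (intro indep_var_compose[OF indep_var_restrict[OF ind]]) auto
  also have "(\<lambda>f. r *\<^sub>R f i) \<circ> (\<lambda>w. restrict (\<lambda>k. X k w) {i}) = (\<lambda>w. r *\<^sub>R X i w)"
    by auto
  also have "(\<lambda>f. \<Sum>k\<in>I. c k *\<^sub>R f k) \<circ> (\<lambda>w. restrict (\<lambda>k. X k w) I) = (\<lambda>w. \<Sum>k\<in>I. c k *\<^sub>R X k w)"
    by auto
  finally show ?thesis .
qed

lemma (in prob_space) distr_scaled_sum_gauss:
  fixes X :: "'i \<Rightarrow> 'a \<Rightarrow> 'b::euclidean_space"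
  assumes "finite I" and "indep_vars (\<lambda>_. borel) X I"
    and "\<And>i. i \<in> I \<Longrightarrow> distr M borel (X i) = gauss (v i)" and "\<And>i. i \<in> I \<Longrightarrow> v i \<ge> 0"
  shows "distr M borel (\<lambda>w. \<Sum>i\<in>I. c i *\<^sub>R X i w) = gauss (\<Sum>i\<in>I. (c i)\<^sup>2 * v i)"
  using assms
proof (induction I rule: finite_induct)
  case empty
  then show ?case by (simp add: gauss_def)
next
  case (insert i I)
  have [measurable]: "X i \<in> borel_measurable M"
    using insert.prems(1) by (auto simp: indep_vars_def)
  have "distr M borel (\<lambda>w. c i *\<^sub>R X i w) = distr (distr M borel (X i)) borel (\<lambda>x. c i *\<^sub>R x)"
    by (subst distr_distr) (auto simp: comp_def)
  also have "\<dots> = gauss ((c i)\<^sup>2 * v i)"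
    using insert.prems by (simp add: gauss_scale)
  finally have i: "distr M borel (\<lambda>w. c i *\<^sub>R X i w) = gauss ((c i)\<^sup>2 * v i)" .
  have I: "distr M borel (\<lambda>w. \<Sum>k\<in>I. c k *\<^sub>R X k w) = gauss (\<Sum>k\<in>I. (c k)\<^sup>2 * v k)"
    using insert.prems by (intro insert.IH) (auto intro: indep_vars_subset)
  have "distr M borel (\<lambda>w. c i *\<^sub>R X i w + (\<Sum>k\<in>I. c k *\<^sub>R X k w)) = gauss ((c i)\<^sup>2 * v i + (\<Sum>k\<in>I. (c k)\<^sup>2 * v k))"
    using insert by (intro distr_add_gauss[OF indep_var_scaled_sum i I]) (auto intro!: sum_nonneg)
  then show ?case using insert.hyps by simp
qed

text \<open>Each real coordinate contributes v / 2. For complex matrices \<open>DIM('a) / 2\<close>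
  is the number of entries, hence this factor in every distortion and rate formula below.\<close>

lemma nn_integral_gauss_norm_square:
  assumes v: "v > 0"
  shows "(\<integral>\<^sup>+x. ennreal ((norm x)\<^sup>2) \<partial>(gauss v::'a::euclidean_space measure)) = ennreal (DIM('a) / 2 * v)"
proof -
  let ?n = "normal_density 0 (sqrt (v / 2))"
  \<comment> \<open>\<open>?f b c\<close> is the factor for coordinate c in the density times the
    square of coordinate b: only the factor with c = b carries the weight.\<close>
  let ?f = "\<lambda>b c t. if c = b then ennreal (?n t * t\<^sup>2) else ennreal (?n t)"
  have s: "sqrt (v / 2) > 0" using v by simp
  have m2: "(\<integral>\<^sup>+t. ennreal (?n t * t\<^sup>2) \<partial>lborel) = ennreal (v / 2)"
    using v normal_moment_even[of "sqrt (v / 2)" 0 1]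
    by (subst nn_integral_eq_integral)
       (auto simp: has_bochner_integral_iff fact_2 power_divide)
  have prod_eq: "(\<Prod>c\<in>Basis. ?f b c (x \<bullet> c)) = ennreal (gauss_density v x * (x \<bullet> b)\<^sup>2)"
    if b: "b \<in> Basis" for b x :: 'a
  proof -
    have "(\<Prod>c\<in>Basis. ?f b c (x \<bullet> c)) = ennreal (?n (x \<bullet> b) * (x \<bullet> b)\<^sup>2) * (\<Prod>c\<in>Basis - {b}. ennreal (?n (x \<bullet> c)))"
      using b by (subst prod.remove[of _ b]) (auto intro!: prod.cong)
    also have "\<dots> = ennreal ((x \<bullet> b)\<^sup>2 * (?n (x \<bullet> b) * (\<Prod>c\<in>Basis - {b}. ?n (x \<bullet> c))))"
      by (simp add: prod_ennreal ennreal_mult[symmetric] prod_nonneg mult_ac)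
    also have "?n (x \<bullet> b) * (\<Prod>c\<in>Basis - {b}. ?n (x \<bullet> c)) = gauss_density v x"
      unfolding gauss_density_eq_prod[OF v] using b by (subst prod.remove[of Basis b]) auto
    finally show ?thesis by (simp add: mult.commute)
  qed
  have "(\<integral>\<^sup>+x. ennreal ((norm x)\<^sup>2) \<partial>(gauss v::'a::euclidean_space measure))
      = (\<integral>\<^sup>+x. (\<Sum>b\<in>Basis. ennreal (gauss_density v x * (x \<bullet> b)\<^sup>2)) \<partial>(lborel::'a measure))"
  proof (subst nn_integral_gauss, simp, simp add: v, intro nn_integral_cong)
    fix x :: 'a
    have "(norm x)\<^sup>2 = (\<Sum>b\<in>Basis. (x \<bullet> b)\<^sup>2)"
      unfolding power2_norm_eq_inner euclidean_inner[of x x] by (simp add: power2_eq_square)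
    then show "ennreal (gauss_density v x) * ennreal ((norm x)\<^sup>2) = (\<Sum>b\<in>Basis. ennreal (gauss_density v x * (x \<bullet> b)\<^sup>2))"
      using gauss_density_nonneg[OF v, of x]
      by (simp add: sum_ennreal ennreal_mult[symmetric] sum_distrib_left sum_nonneg)
  qed
  also have "\<dots> = (\<Sum>b\<in>Basis. (\<integral>\<^sup>+x. ennreal (gauss_density v x * (x \<bullet> b)\<^sup>2) \<partial>(lborel::'a measure)))"
    by (rule nn_integral_sum) auto
  also have "\<dots> = (\<Sum>b\<in>(Basis::'a set). ennreal (v / 2))"
  proof (rule sum.cong)
    fix b :: 'a assume b: "b \<in> Basis"
    have "(\<integral>\<^sup>+x. ennreal (gauss_density v x * (x \<bullet> b)\<^sup>2) \<partial>lborel) = (\<integral>\<^sup>+x. (\<Prod>c\<in>Basis. ?f b c (x \<bullet> c)) \<partial>lborel)"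
      by (simp add: prod_eq[OF b])
    also have "\<dots> = (\<Prod>c\<in>Basis. (\<integral>\<^sup>+t. ?f b c t \<partial>lborel))"
      by (rule nn_integral_lborel_prod) auto
    also have "\<dots> = ennreal (v / 2) * (\<Prod>c\<in>Basis - {b}. 1)"
      using b s m2 by (subst prod.remove[of _ b]) (auto simp: nn_integral_normal_density intro!: prod.neutral)
    finally show "(\<integral>\<^sup>+x. ennreal (gauss_density v x * (x \<bullet> b)\<^sup>2) \<partial>lborel) = ennreal (v / 2)" by simp
  qed simp
  also have "\<dots> = ennreal (DIM('a) / 2 * v)"
    using v by (simp add: ennreal_of_nat_eq_real_of_nat ennreal_mult[symmetric])
  finally show ?thesis .
qed

section \<open>Identification of iid complex Gaussian matrices with \<open>gauss\<close>\<close>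

lemma emeasure_gauss_box:
  fixes l u :: "'a::euclidean_space"
  assumes "v \<ge> 0"
  shows "emeasure (gauss v) (box l u) = (\<Prod>b\<in>Basis. emeasure (gauss v) (box (l \<bullet> b) (u \<bullet> b)))"
proof (cases "v = 0")
  case True
  have "(indicator (box l u) 0 :: ennreal) = (\<Prod>b\<in>Basis. indicator {l \<bullet> b<..<u \<bullet> b} 0)"
    by (auto simp: mem_box indicator_def)
  then show ?thesis using True by (simp add: gauss_def)
next
  case False
  with assms have v: "v > 0" by simp
  let ?n = "normal_density 0 (sqrt (v / 2))"
  have real: "emeasure (gauss v) (box p q) = (\<integral>\<^sup>+t. ennreal (?n t) * indicator {p<..<q} t \<partial>lborel)"
    for p q :: real
    using v by (simp add: gauss_def emeasure_density gauss_density_eq_prod)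
  have ind: "(indicator (box l u) x :: ennreal) = (\<Prod>b\<in>Basis. indicator {l \<bullet> b<..<u \<bullet> b} (x \<bullet> b))" for x
    by (auto simp: mem_box indicator_def)
  have "emeasure (gauss v) (box l u) = (\<integral>\<^sup>+x. ennreal (gauss_density v x) * indicator (box l u) x \<partial>lborel)"
    using v by (simp add: gauss_def emeasure_density)
  also have "\<dots> = (\<integral>\<^sup>+x. (\<Prod>b\<in>Basis. ennreal (?n (x \<bullet> b)) * indicator {l \<bullet> b<..<u \<bullet> b} (x \<bullet> b)) \<partial>lborel)"
    unfolding ind gauss_density_eq_prod[OF v] prod.distrib by (simp add: prod_ennreal)
  also have "\<dots> = (\<Prod>b\<in>Basis. (\<integral>\<^sup>+t. ennreal (?n t) * indicator {l \<bullet> b<..<u \<bullet> b} t \<partial>lborel))"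
    by (rule nn_integral_lborel_prod) auto
  finally show ?thesis by (simp only: real)
qed

text \<open>Open boxes are closed under intersection, generate the Borel sets and exhaust the space,
  so they determine a finite measure. Laws given entrywise can thus be compared by multiplying box
  probabilities.\<close>

lemma measure_eq_gaussI:
  fixes N :: "'a::euclidean_space measure"
  assumes "sets N = sets borel" and "v \<ge> 0"
    and "\<And>l u. emeasure N (box l u) = emeasure (gauss v) (box l u)"
  shows "N = gauss v"
proof -
  interpret G: prob_space "gauss v :: 'a measure" by (rule prob_space_gauss) fact
  show ?thesis
  proof (rule measure_eqI_generator_eq)
    let ?E = "range (\<lambda>(a, b). box a b :: 'a set)"
    show "Int_stable ?E"
      by (auto simp: Int_stable_def box_Int_box)
    show "?E \<subseteq> Pow UNIV" "sets N = sigma_sets UNIV ?E" "sets (gauss v :: 'a measure) = sigma_sets UNIV ?E"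
      by (simp_all add: borel_eq_box assms)
    let ?A = "\<lambda>n::nat. box (- (real n *\<^sub>R One)) (real n *\<^sub>R One) :: 'a set"
    show "range ?A \<subseteq> ?E" "(\<Union>i. ?A i) = UNIV"
      unfolding UN_box_eq_UNIV by auto
    show "emeasure N (?A i) \<noteq> \<infinity>" for i
      using assms by simp
    show "emeasure N X = emeasure (gauss v) X" if "X \<in> ?E" for X
      using that assms by auto
  qed
qed

lemma complex_normal_eq_gauss:
  assumes "v \<ge> 0"
  shows "complex_normal v = gauss v"
proof (rule measure_eq_gaussI)
  show "sets (complex_normal v) = sets borel" by (simp add: complex_normal_def)
  show "v \<ge> 0" by fact
  fix l u :: complex
  let ?s = "sqrt (v / 2)" and ?N = std_normal_distribution
  let ?S = "\<lambda>a b. {t. ?s * t \<in> box a b}"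
  \<comment> \<open>\<open>gauss v\<close> gives a real coordinate the variance v / 2, so unit
    variance is v = 2.\<close>
  have "?N = gauss 2"
    by (simp add: gauss_def std_normal_density_def[abs_def] gauss_density_def[abs_def] mult.commute)
  hence "distr ?N borel (\<lambda>x. ?s *\<^sub>R x) = gauss (?s\<^sup>2 * 2)"
    using gauss_scale[of 2 ?s, where 'a = real] by simp
  also have "?s\<^sup>2 * 2 = v" using assms by simp
  finally have g: "distr ?N borel (\<lambda>x. ?s * x) = gauss v" by simp
  have S: "emeasure ?N (?S a b) = emeasure (gauss v) (box a b)" for a b
    unfolding g[symmetric] by (subst emeasure_distr) (auto simp: vimage_def)
  have [measurable]: "?S a b \<in> sets borel" for a b by measurable
  interpret N: prob_space ?N by (rule prob_space_normal_density) simp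
  have [measurable]: "(\<lambda>(x, y). complex_of_real ?s * Complex x y) \<in> borel_measurable (?N \<Otimes>\<^sub>M ?N)"
  proof -
    have "(\<lambda>(x, y). complex_of_real ?s * Complex x y)
      = (\<lambda>p. complex_of_real ?s * (complex_of_real (fst p) + \<i> * complex_of_real (snd p)))"
      by (auto simp: complex_eq_iff)
    moreover have "\<dots> \<in> borel_measurable (?N \<Otimes>\<^sub>M ?N)" by measurable
    ultimately show ?thesis by simp
  qed
  have "emeasure (complex_normal v) (box l u) = emeasure (?N \<Otimes>\<^sub>M ?N) (?S (Re l) (Re u) \<times> ?S (Im l) (Im u))"
    unfolding complex_normal_def
    by (subst emeasure_distr)
       (auto simp: space_pair_measure mem_box Basis_complex_def inner_complex_def intro!: arg_cong[where f = "emeasure _"])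
  also have "\<dots> = emeasure (gauss v) (box (Re l) (Re u)) * emeasure (gauss v) (box (Im l) (Im u))"
    by (subst N.emeasure_pair_measure_Times) (simp_all only: S, simp_all)
  also have "\<dots> = emeasure (gauss v) (box l u)"
    unfolding emeasure_gauss_box[OF assms, of l u] by (simp add: Basis_complex_def inner_complex_def complex_eq_iff)
  finally show "emeasure (complex_normal v) (box l u) = emeasure (gauss v) (box l u)" .
qed

lemma prod_Basis_vec:
  "(\<Prod>b\<in>(Basis :: ('a::euclidean_space ^ 'n::finite) set). g b) = (\<Prod>i\<in>UNIV. \<Prod>b\<in>Basis. g (axis i b))"
proof -
  have eq: "(Basis :: ('a ^ 'n) set) = (\<lambda>(i, b). axis i b) ` (UNIV \<times> Basis)"
    by (auto simp: Basis_vec_def)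
  have inj: "inj_on (\<lambda>(i, b). axis i b) ((UNIV :: 'n set) \<times> (Basis :: 'a set))"
    by (auto simp: inj_on_def axis_eq_axis)
  show ?thesis
    by (subst eq, subst prod.reindex[OF inj]) (simp add: prod.cartesian_product case_prod_unfold)
qed

lemma emeasure_gauss_box_vec:
  fixes l u :: "'a::euclidean_space ^ 'n::finite"
  assumes "v \<ge> 0"
  shows "emeasure (gauss v) (box l u) = (\<Prod>i\<in>UNIV. emeasure (gauss v) (box (l $ i) (u $ i)))"
  unfolding emeasure_gauss_box[OF assms, of l u] emeasure_gauss_box[OF assms, of "l $ _" "u $ _"]
  by (simp add: prod_Basis_vec inner_axis)

lemma mem_box_vec:
  fixes x l u :: "'a::euclidean_space ^ 'n::finite"
  shows "x \<in> box l u \<longleftrightarrow> (\<forall>i. x $ i \<in> box (l $ i) (u $ i))"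
  by (auto simp: mem_box Basis_vec_def inner_axis)

text \<open>Box probabilities factor over the entries on both sides: by independence for the matrix,
  and by \<open>emeasure_gauss_box_vec\<close>, applied to the rows and then within each row, for
  \<open>gauss\<close>.\<close>

lemma (in prob_space) distr_iid_complex_normal:
  fixes A :: "'a \<Rightarrow> complex ^ 't::finite ^ 'r::finite"
  assumes iid: "iid_complex_normal M v A" and v: "v \<ge> 0" and [measurable]: "A \<in> borel_measurable M"
  shows "distr M borel A = gauss v"
proof (rule measure_eq_gaussI)
  fix l u :: "complex ^ 't ^ 'r"
  let ?X = "\<lambda>(i, j) w. A w $ i $ j" and ?B = "\<lambda>(i, j). box (l $ i $ j) (u $ i $ j)"
  have ind: "indep_vars (\<lambda>_. borel) ?X UNIV"
    and law: "distr M borel (\<lambda>w. A w $ i $ j) = gauss v" for i j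
    using iid v by (auto simp: iid_complex_normal_def complex_normal_eq_gauss)
  have rv [measurable]: "(\<lambda>w. A w $ i $ j) \<in> borel_measurable M" for i j
    using ind by (auto simp: indep_vars_def)
  have pre: "emeasure M ((\<lambda>w. A w $ i $ j) -` S \<inter> space M) = emeasure (gauss v) S" if "S \<in> sets borel" for i j S
    using that by (simp add: law[of i j, symmetric] emeasure_distr)
  have "emeasure (distr M borel A) (box l u) = emeasure M (\<Inter>k\<in>UNIV. ?X k -` ?B k \<inter> space M)"
    by (subst emeasure_distr) (auto simp: mem_box_vec intro!: arg_cong[where f = "emeasure M"])
  also have "\<dots> = ennreal (\<Prod>k\<in>UNIV. prob (?X k -` ?B k \<inter> space M))"
    unfolding emeasure_eq_measure by (subst indep_varsD_finite[OF ind]) auto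
  also have "\<dots> = (\<Prod>k\<in>UNIV. emeasure (gauss v) (?B k))"
    unfolding prod_ennreal[symmetric, OF measure_nonneg] emeasure_eq_measure[symmetric]
    by (intro prod.cong refl) (auto simp: pre)
  also have "\<dots> = (\<Prod>i\<in>UNIV. \<Prod>j\<in>UNIV. emeasure (gauss v) (box (l $ i $ j) (u $ i $ j)))"
    by (simp add: prod.cartesian_product case_prod_unfold)
  also have "\<dots> = emeasure (gauss v) (box l u)"
    by (simp add: emeasure_gauss_box_vec v)
  finally show "emeasure (distr M borel A) (box l u) = emeasure (gauss v) (box l u)" .
qed (use v in simp_all)

section \<open>The Bessel function is bounded by 1\<close>

text \<open>With \<open>J\<^sub>0(x) = g((x/2)\<^sup>2)\<close>, Bessel's equation becomes \<open>(t g'(t))' = - g(t)\<close>, so the energy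
  \<open>g\<^sup>2 + t g'\<^sup>2\<close> has derivative \<open>- g'\<^sup>2 \<le> 0\<close> and is bounded by its value \<open>1\<close> at \<open>t = 0\<close>.\<close>

lemma abs_bessel_J0_le_1: "\<bar>bessel_J0 x\<bar> \<le> 1"
proof -
  define a :: "nat \<Rightarrow> real" where "a k = (-1) ^ k / (fact k)\<^sup>2" for k
  define g where "g t = (\<Sum>k. a k * t ^ k)" for t
  define g1 where "g1 t = (\<Sum>k. diffs a k * t ^ k)" for t
  define g2 where "g2 t = (\<Sum>k. diffs (diffs a) k * t ^ k)" for t
  have sum_a: "summable (\<lambda>k. a k * t ^ k)" for t
  proof (rule summable_comparison_test')
    show "summable (\<lambda>k. \<bar>t\<bar> ^ k /\<^sub>R fact k)" by (rule summable_exp_generic)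
    fix k :: nat
    have "1 \<le> (fact k :: real)" by (rule fact_ge_1)
    hence "fact k \<le> (fact k :: real)\<^sup>2" by (simp add: power2_eq_square)
    hence "\<bar>t\<bar> ^ k / (fact k)\<^sup>2 \<le> \<bar>t\<bar> ^ k / fact k"
      by (intro divide_left_mono) auto
    then show "norm (a k * t ^ k) \<le> \<bar>t\<bar> ^ k /\<^sub>R fact k"
      by (simp add: a_def abs_mult power_abs divide_inverse mult.commute)
  qed
  have sum_d: "summable (\<lambda>k. diffs a k * t ^ k)" for t
    using sum_a by (rule termdiff_converges_all)
  have dg: "(g has_field_derivative g1 t) (at t)" for t
    unfolding g_def[abs_def] g1_def using sum_a by (rule termdiffs_strong_converges_everywhere)
  have dg1: "(g1 has_field_derivative g2 t) (at t)" for t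
    unfolding g1_def[abs_def] g2_def using sum_d by (rule termdiffs_strong_converges_everywhere)
  have ode: "g1 t + t * g2 t = - g t" for t
  proof -
    let ?b = "\<lambda>k. real k * a k"
    have tg: "t * g1 t = (\<Sum>k. ?b k * t ^ k)" and sum_b: "summable (\<lambda>k. ?b k * t ^ k)" for t
    proof -
      have "(\<lambda>k. diffs a k * t ^ k) sums g1 t"
        unfolding g1_def using sum_d by (rule summable_sums)
      from sums_mult[OF this, of t] have "(\<lambda>k. ?b (Suc k) * t ^ Suc k) sums (t * g1 t)"
        by (simp add: diffs_def mult_ac)
      \<comment> \<open>The term at index 0 vanishes because of the factor k, so the shifted series
        has the same sum.\<close>
      then have "(\<lambda>k. ?b k * t ^ k) sums (t * g1 t)"
        using sums_Suc[of "\<lambda>k. ?b k * t ^ k"] by simp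
      then show "t * g1 t = (\<Sum>k. ?b k * t ^ k)" "summable (\<lambda>k. ?b k * t ^ k)"
        by (auto simp: sums_iff)
    qed
    \<comment> \<open>This is the recursion \<open>(k + 1)\<^sup>2 * a (k + 1) = - a k\<close>, the
      differential equation in terms of coefficients.\<close>
    have "diffs ?b k = - a k" for k
    proof -
      have "c * (c * (- s / (c\<^sup>2 * F))) = - s / F" if "c \<noteq> 0" for c s F :: real
        using that by (simp add: power2_eq_square)
      from this[of "real (Suc k)" "(-1) ^ k" "(fact k)\<^sup>2"] show ?thesis
        by (simp add: diffs_def a_def power_mult_distrib)
    qed
    moreover have "((\<lambda>t. \<Sum>k. ?b k * t ^ k) has_field_derivative (\<Sum>k. diffs ?b k * t ^ k)) (at t)"
      using sum_b by (rule termdiffs_strong_converges_everywhere)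
    ultimately have "((\<lambda>t. t * g1 t) has_field_derivative - g t) (at t)"
      using sum_a by (simp add: tg g_def suminf_minus)
    moreover have "((\<lambda>t. t * g1 t) has_field_derivative g1 t + t * g2 t) (at t)"
      by (auto intro!: derivative_eq_intros dg1)
    ultimately show ?thesis by (metis DERIV_unique)
  qed
  define E where "E t = (g t)\<^sup>2 + t * (g1 t)\<^sup>2" for t
  have dE: "(E has_field_derivative - (g1 t)\<^sup>2) (at t)" for t
  proof -
    have "(E has_field_derivative 2 * g t * g1 t + ((g1 t)\<^sup>2 + t * (2 * g1 t * g2 t))) (at t)"
      unfolding E_def[abs_def] by (auto intro!: derivative_eq_intros dg dg1)
    moreover have "2 * g t * g1 t + ((g1 t)\<^sup>2 + t * (2 * g1 t * g2 t)) = - (g1 t)\<^sup>2"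
    proof -
      have "t * g2 t = - g t - g1 t" using ode[of t] by simp
      hence "t * (2 * g1 t * g2 t) = 2 * g1 t * (- g t - g1 t)" by (metis mult.assoc mult.left_commute)
      then show ?thesis by (simp add: power2_eq_square algebra_simps)
    qed
    ultimately show ?thesis by simp
  qed
  let ?t = "(x / 2)\<^sup>2"
  have "E ?t \<le> E 0"
    by (rule DERIV_nonpos_imp_nonincreasing[of 0 ?t]) (use dE in \<open>force+\<close>)
  moreover have "(g ?t)\<^sup>2 \<le> E ?t" by (simp add: E_def)
  moreover have "g 0 = a 0" unfolding g_def by (rule powser_zero)
  hence "E 0 = 1" by (simp add: E_def a_def)
  moreover have "bessel_J0 x = g ?t"
    by (simp add: bessel_J0_def g_def a_def power_mult)
  ultimately show ?thesis by (simp add: abs_square_le_1[symmetric])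
qed

section \<open>Divergence and conditional laws\<close>

text \<open>Easy half of the Donsker-Varadhan formula. With D the density of P with respect to Q,
  \<open>ln (exp (f x) / D x)\<close> is at most \<open>exp (f x) / D x - 1\<close>, whose
  P-integral is at most 0 by the normalization of f. In the remaining cases the divergence is
  infinite by definition. Dividing by \<open>ln b\<close> changes to base b.\<close>

lemma KL_divergence_ext_ge:
  fixes f :: "'a \<Rightarrow> real"
  assumes "prob_space Q" "prob_space P" and sets [measurable_cong]: "sets P = sets Q" and b: "b > 1"
    and f [measurable]: "f \<in> borel_measurable Q" and exp: "(\<integral>\<^sup>+x. ennreal (exp (f x)) \<partial>Q) \<le> 1"
    and int: "integrable P f"
  shows "ereal ((\<integral>x. f x \<partial>P) / ln b) \<le> KL_divergence_ext b Q P"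
proof (cases "absolutely_continuous Q P \<and> integrable P (entropy_density b Q P)")
  case False
  then show ?thesis unfolding KL_divergence_ext_def by (simp only: if_False) simp
next
  case True
  interpret Q: prob_space Q by fact
  interpret P: prob_space P by fact
  obtain D where D [measurable]: "D \<in> borel_measurable Q" and RN: "AE x in Q. RN_deriv Q P x = ennreal (D x)"
    and pos: "AE x in P. 0 < D x" and nn: "\<And>x. 0 \<le> D x"
    by (rule Q.real_RN_deriv[OF P.finite_measure_axioms _ sets]) (use True in auto)
  have "P = density Q (RN_deriv Q P)"
    using Q.density_RN_deriv[of P] True sets by simp
  also have "\<dots> = density Q D"
    using RN by (intro density_cong) auto
  finally have P: "P = density Q D" .
  have RN': "AE x in P. RN_deriv Q P x = ennreal (D x)"
    using True RN sets by (auto intro: absolutely_continuous_AE)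
  let ?h = "\<lambda>x. exp (f x) / D x"
  have ln_D: "AE x in P. entropy_density b Q P x = ln (D x) / ln b"
    using RN' by eventually_elim (simp add: entropy_density_def log_def nn)
  have int_ln: "integrable P (\<lambda>x. ln (D x) / ln b)"
    using True ln_D by (subst integrable_cong_AE[of _ _ "entropy_density b Q P"])
      (auto simp: entropy_density_def sets cong: measurable_cong_sets)
  have KL: "KL_divergence b Q P = (\<integral>x. ln (D x) / ln b \<partial>P)"
    unfolding KL_divergence_def using ln_D
    by (intro integral_cong_AE) (auto simp: entropy_density_def)
  have h1: "(\<integral>\<^sup>+x. ennreal (?h x) \<partial>P) \<le> 1"
  proof -
    have "(\<integral>\<^sup>+x. ennreal (?h x) \<partial>P) = (\<integral>\<^sup>+x. ennreal (D x) * ennreal (?h x) \<partial>Q)"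
      unfolding P by (rule nn_integral_density) auto
    \<comment> \<open>Only an inequality: where D vanishes, the left integrand is 0 and the right
      one is positive.\<close>
    also have "\<dots> \<le> (\<integral>\<^sup>+x. ennreal (exp (f x)) \<partial>Q)"
      by (intro nn_integral_mono) (auto simp: ennreal_mult[symmetric] nn)
    finally show ?thesis using exp by simp
  qed
  have int_h: "integrable P ?h"
    using nn order.strict_trans1[OF h1, of top] by (intro integrableI_bounded) auto
  have "ennreal (\<integral>x. ?h x \<partial>P) \<le> 1"
    using h1 int_h nn by (subst nn_integral_eq_integral[symmetric]) auto
  hence h_le: "(\<integral>x. ?h x \<partial>P) \<le> 1" by simp
  have int_diff: "integrable P (\<lambda>x. f x - ln b * (ln (D x) / ln b))"
    by (intro Bochner_Integration.integrable_diff integrable_mult_right int int_ln)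
  have "(\<integral>x. f x \<partial>P) - ln b * KL_divergence b Q P = (\<integral>x. f x - ln b * (ln (D x) / ln b) \<partial>P)"
    unfolding KL Bochner_Integration.integral_diff[OF int integrable_mult_right[OF int_ln]] by (simp only: integral_mult_right_zero)
  also have "\<dots> \<le> (\<integral>x. ?h x - 1 \<partial>P)"
  proof (rule integral_mono_AE)
    show "AE x in P. f x - ln b * (ln (D x) / ln b) \<le> ?h x - 1"
      using pos
    proof eventually_elim
      case (elim x)
      have "f x - ln (D x) = ln (?h x)" using elim by (simp add: ln_div)
      also have "\<dots> \<le> ?h x - 1" using elim by (intro ln_le_minus_one) simp
      finally show ?case using b by simp
    qed
  qed (rule int_diff, use int_h in simp)
  also have "\<dots> \<le> 0" using h_le int_h by (simp add: P.prob_space)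
  finally have "(\<integral>x. f x \<partial>P) \<le> ln b * KL_divergence b Q P"
    by simp
  hence "(\<integral>x. f x \<partial>P) / ln b \<le> KL_divergence b Q P"
    using b by (simp add: field_simps)
  then show ?thesis using True unfolding KL_divergence_ext_def by simp
qed

text \<open>Here \<open>exp (f x)\<close> is itself the density, so the estimate above loses
  nothing. With f = 0 it also yields divergence 0 of a law from itself.\<close>

lemma KL_divergence_ext_density_exp:
  fixes f :: "'a \<Rightarrow> real"
  assumes "prob_space Q" and f [measurable]: "f \<in> borel_measurable Q"
    and P: "P = density Q (\<lambda>x. ennreal (exp (f x)))" and int: "integrable P f" and b: "b > 1"
  shows "KL_divergence_ext b Q P = ereal ((\<integral>x. f x \<partial>P) / ln b)"
proof -
  interpret Q: prob_space Q by fact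
  have sets [measurable_cong]: "sets P = sets Q" by (simp add: P)
  have ac: "absolutely_continuous Q P" unfolding P
    by (auto simp: absolutely_continuousI_density)
  have "AE x in Q. ennreal (exp (f x)) = RN_deriv Q P x"
    by (rule Q.RN_deriv_unique) (auto simp: P)
  hence "AE x in P. ennreal (exp (f x)) = RN_deriv Q P x"
    using ac sets by (auto intro: absolutely_continuous_AE)
  hence eq: "AE x in P. entropy_density b Q P x = f x / ln b"
  proof eventually_elim
    case (elim x)
    then show ?case using elim[symmetric] by (simp add: entropy_density_def log_def)
  qed
  have meas: "entropy_density b Q P \<in> borel_measurable P"
    by (simp add: entropy_density_def)
  have "integrable P (entropy_density b Q P)"
    using eq meas int by (subst integrable_cong_AE[of _ _ "\<lambda>x. f x / ln b"]) auto
  moreover have "KL_divergence b Q P = (\<integral>x. f x / ln b \<partial>P)"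
    unfolding KL_divergence_def using eq meas by (intro integral_cong_AE) auto
  ultimately show ?thesis using ac by (simp add: KL_divergence_ext_def)
qed

section \<open>Uniqueness of regular conditional laws\<close>

lemma borel_countable_Int_stable_generator:
  obtains E :: "'a::second_countable_topology set set"
  where "countable E" "Int_stable E" "UNIV \<in> E" "sets borel = sigma_sets UNIV E"
proof -
  obtain B :: "'a set set" where B: "countable B" "topological_basis B"
    using ex_countable_basis by blast
  \<comment> \<open>Closing a countable basis under finite intersections keeps it countable; the
    empty intersection puts \<open>UNIV\<close> into it, which serves as the exhausting set when
    measures are compared on the generator.\<close>
  let ?E = "Inter ` {F. finite F \<and> F \<subseteq> B}"
  have sB: "sets borel = sigma_sets UNIV B"
    using B by (simp add: borel_eq_countable_basis)
  have "sigma_sets UNIV B = sigma_sets UNIV ?E"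
  proof (rule sigma_sets_eqI)
    fix b assume "b \<in> B"
    then have "b = \<Inter>{b}" "finite {b}" "{b} \<subseteq> B" by auto
    then show "b \<in> sigma_sets UNIV ?E" by (blast intro: sigma_sets.Basic)
  next
    fix e assume "e \<in> ?E"
    then obtain F where F: "finite F" "F \<subseteq> B" "e = \<Inter>F" by auto
    have "open e"
      unfolding F(3) using F B by (intro open_Inter) (auto dest: topological_basis_open)
    then have "e \<in> sets borel" by simp
    then show "e \<in> sigma_sets UNIV B" using sB by simp
  qed
  moreover have "countable ?E"
    using B(1) by (intro countable_image) (simp add: countable_Collect_finite_subset)
  moreover have "Int_stable ?E"
  proof (rule Int_stableI)
    fix a b assume "a \<in> ?E" "b \<in> ?E"
    then obtain F G where "finite F" "F \<subseteq> B" "a = \<Inter>F" "finite G" "G \<subseteq> B" "b = \<Inter>G" by auto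
    then show "a \<inter> b \<in> ?E"
      by (intro image_eqI[of _ _ "F \<union> G"]) auto
  qed
  moreover have "UNIV \<in> ?E" by (rule image_eqI[of _ _ "{}"]) auto
  ultimately show ?thesis using that sB by simp
qed

text \<open>For a fixed set A, both kernels evaluated at A are densities of the same measure with
  respect to the law of Z, hence agree almost everywhere. Countably many exceptional sets can be
  united, and a generator stable under intersections determines each probability measure.\<close>

lemma is_cond_law_unique:
  fixes X :: "'w \<Rightarrow> 'a::second_countable_topology"
  assumes "prob_space P" and Z [measurable]: "Z \<in> P \<rightarrow>\<^sub>M U"
    and "is_cond_law P borel U X Z \<kappa>" and "is_cond_law P borel U X Z \<kappa>'"
  shows "AE z in distr P U Z. \<kappa> z = \<kappa>' z"
proof -
  interpret P: prob_space P by fact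
  let ?PZ = "distr P U Z"
  interpret PZ: prob_space ?PZ by (rule P.prob_space_distr) fact
  note cl = assms(3,4)[unfolded is_cond_law_def]
  have m [measurable]: "\<kappa> \<in> U \<rightarrow>\<^sub>M subprob_algebra borel" "\<kappa>' \<in> U \<rightarrow>\<^sub>M subprob_algebra borel"
    using cl by (auto intro: measurable_prob_algebraD)
  obtain E :: "'a set set" where E: "countable E" "Int_stable E" "UNIV \<in> E" "sets borel = sigma_sets UNIV E"
    by (rule borel_countable_Int_stable_generator)
  have "AE z in ?PZ. emeasure (\<kappa> z) A = emeasure (\<kappa>' z) A" if "A \<in> E" for A
  proof -
    have A [measurable]: "A \<in> sets borel" using that E(4) by auto
    have "density ?PZ (\<lambda>z. emeasure (\<kappa> z) A) = density ?PZ (\<lambda>z. emeasure (\<kappa>' z) A)"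
    proof (rule measure_eqI)
      fix C assume "C \<in> sets (density ?PZ (\<lambda>z. emeasure (\<kappa> z) A))"
      then have C [measurable]: "C \<in> sets U" by simp
      show "emeasure (density ?PZ (\<lambda>z. emeasure (\<kappa> z) A)) C = emeasure (density ?PZ (\<lambda>z. emeasure (\<kappa>' z) A)) C"
        using cl A C by (simp add: emeasure_density)
    qed simp
    then show ?thesis by (intro PZ.density_unique) auto
  qed
  then have "AE z in ?PZ. \<forall>A\<in>E. emeasure (\<kappa> z) A = emeasure (\<kappa>' z) A"
    using E(1) by (simp add: AE_ball_countable)
  moreover have "AE z in ?PZ. z \<in> space U" by (rule AE_I2) simp
  ultimately show ?thesis
  proof eventually_elim
    case (elim z)
    have \<kappa>: "sets (\<kappa> z) = sets borel" "prob_space (\<kappa> z)" "sets (\<kappa>' z) = sets borel"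
      using cl elim(2) by (auto dest!: measurable_space simp: space_prob_algebra)
    show ?case
      using elim(1) E \<kappa> by (intro measure_eqI_generator_eq[of E UNIV _ _ "\<lambda>_. UNIV"])
        (auto simp: finite_measure.emeasure_finite prob_space_def)
  qed
qed

text \<open>The choice operator yields a conditional law as soon as some kernel is one;
  \<open>N\<close> and \<open>N_out\<close> below provide the witnesses.\<close>

lemma is_cond_law_cond_law:
  assumes "is_cond_law P S U X Z \<kappa>"
  shows "is_cond_law P S U X Z (cond_law P S U X Z)"
  unfolding cond_law_def using assms by (rule someI[of "is_cond_law P S U X Z"])

section \<open>Joint laws assembled from kernels\<close>

definition joint_law ::
  "'c measure \<Rightarrow> ('c \<Rightarrow> 'a measure) \<Rightarrow> ('a \<times> 'c \<Rightarrow> 'b measure) \<Rightarrow>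
    ('a::euclidean_space \<times> 'b::euclidean_space \<times> 'c::euclidean_space) measure" where
  "joint_law R N K = R \<bind> (\<lambda>z. N z \<bind> (\<lambda>x. K (x, z) \<bind> (\<lambda>y. return (borel \<Otimes>\<^sub>M borel \<Otimes>\<^sub>M borel) (x, y, z))))"

locale kernel_chain =
  fixes R :: "'c::euclidean_space measure" and N :: "'c \<Rightarrow> 'a::euclidean_space measure"
    and K :: "'a \<times> 'c \<Rightarrow> 'b::euclidean_space measure"
  assumes R: "R \<in> space (prob_algebra borel)"
    and N [measurable]: "N \<in> borel \<rightarrow>\<^sub>M prob_algebra borel"
    and K [measurable]: "K \<in> borel \<Otimes>\<^sub>M borel \<rightarrow>\<^sub>M prob_algebra borel"
begin

sublocale R: prob_space R
  using R by (simp add: space_prob_algebra)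

lemma sets_R [simp, measurable_cong]: "sets R = sets borel"
  using R by (simp add: space_prob_algebra)

abbreviation "T \<equiv> joint_law R N K"

lemma N' [measurable]: "N \<in> borel \<rightarrow>\<^sub>M subprob_algebra borel"
  using N by (rule measurable_prob_algebraD)

lemma K' [measurable]: "K \<in> borel \<Otimes>\<^sub>M borel \<rightarrow>\<^sub>M subprob_algebra borel"
  using K by (rule measurable_prob_algebraD)

lemma sets_N [simp]: "sets (N z) = sets borel" and prob_space_N: "prob_space (N z)"
  using measurable_space[OF N, of z] by (auto simp: space_prob_algebra)

lemma sets_K [simp]: "sets (K p) = sets borel" and prob_space_K: "prob_space (K p)"
  using measurable_space[OF K, of p] by (auto simp: space_prob_algebra space_pair_measure)

lemma T_in: "T \<in> space (prob_algebra (borel \<Otimes>\<^sub>M borel \<Otimes>\<^sub>M borel))"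
proof -
  have "(\<lambda>R. joint_law R N K) \<in> prob_algebra borel \<rightarrow>\<^sub>M prob_algebra (borel \<Otimes>\<^sub>M borel \<Otimes>\<^sub>M borel)"
    unfolding joint_law_def by measurable
  from measurable_space[OF this R] show ?thesis .
qed

sublocale T: prob_space T
  using T_in by (simp add: space_prob_algebra)

lemma sets_T [simp, measurable_cong]: "sets T = sets (borel \<Otimes>\<^sub>M borel \<Otimes>\<^sub>M borel)"
  using T_in by (simp add: space_prob_algebra)

lemma space_T [simp]: "space T = UNIV"
  using sets_eq_imp_space_eq[OF sets_T] by (simp add: space_pair_measure)

lemma nn_integral_T:
  assumes [measurable]: "f \<in> borel_measurable (borel \<Otimes>\<^sub>M borel \<Otimes>\<^sub>M borel)"
  shows "(\<integral>\<^sup>+p. f p \<partial>T) = (\<integral>\<^sup>+z. (\<integral>\<^sup>+x. (\<integral>\<^sup>+y. f (x, y, z) \<partial>K (x, z)) \<partial>N z) \<partial>R)"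
proof -
  let ?ret = "return (borel \<Otimes>\<^sub>M borel \<Otimes>\<^sub>M borel)"
  have 1: "(\<integral>\<^sup>+p. f p \<partial>(K (x, z) \<bind> (\<lambda>y. ?ret (x, y, z)))) = (\<integral>\<^sup>+y. f (x, y, z) \<partial>K (x, z))" for x z
    by (subst nn_integral_bind[where B = "borel \<Otimes>\<^sub>M borel \<Otimes>\<^sub>M borel"])
       (auto simp: nn_integral_return space_pair_measure cong: measurable_cong_sets)
  have m: "(\<lambda>x. K (x, z) \<bind> (\<lambda>y. ?ret (x, y, z))) \<in> borel \<rightarrow>\<^sub>M prob_algebra (borel \<Otimes>\<^sub>M borel \<Otimes>\<^sub>M borel)" for z
    by measurable
  have 2: "(\<integral>\<^sup>+p. f p \<partial>(N z \<bind> (\<lambda>x. K (x, z) \<bind> (\<lambda>y. ?ret (x, y, z)))))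
      = (\<integral>\<^sup>+x. (\<integral>\<^sup>+y. f (x, y, z) \<partial>K (x, z)) \<partial>N z)" for z
    using measurable_prob_algebraD[OF m]
    by (subst nn_integral_bind[where B = "borel \<Otimes>\<^sub>M borel \<Otimes>\<^sub>M borel"]) (auto simp: 1 cong: measurable_cong_sets)
  have "(\<lambda>z. N z \<bind> (\<lambda>x. K (x, z) \<bind> (\<lambda>y. ?ret (x, y, z)))) \<in> borel \<rightarrow>\<^sub>M prob_algebra (borel \<Otimes>\<^sub>M borel \<Otimes>\<^sub>M borel)"
    by measurable
  from measurable_prob_algebraD[OF this] show ?thesis
    unfolding joint_law_def
    by (subst nn_integral_bind[where B = "borel \<Otimes>\<^sub>M borel \<Otimes>\<^sub>M borel"]) (auto simp: 2 cong: measurable_cong_sets)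
qed

lemma emeasure_T:
  assumes [measurable]: "A \<in> sets (borel \<Otimes>\<^sub>M borel \<Otimes>\<^sub>M borel)"
  shows "emeasure T A = (\<integral>\<^sup>+z. (\<integral>\<^sup>+x. (\<integral>\<^sup>+y. indicator A (x, y, z) \<partial>K (x, z)) \<partial>N z) \<partial>R)"
  using nn_integral_T[of "indicator A"] by simp

lemma distr_T_third: "distr T borel (\<lambda>(x, y, z). z) = R"
proof (rule measure_eqI)
  fix A assume "A \<in> sets (distr T borel (\<lambda>(x, y, z). z))"
  then have [measurable]: "A \<in> sets borel" by simp
  have "emeasure (distr T borel (\<lambda>(x, y, z). z)) A = (\<integral>\<^sup>+p. indicator A (snd (snd p)) \<partial>T)"
    by (simp add: nn_integral_indicator[symmetric] nn_integral_distr case_prod_unfold del: nn_integral_indicator)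
  also have "\<dots> = emeasure R A"
    using prob_space.emeasure_space_1[OF prob_space_N] prob_space.emeasure_space_1[OF prob_space_K]
    by (subst nn_integral_T) auto
  finally show "emeasure (distr T borel (\<lambda>(x, y, z). z)) A = emeasure R A" .
qed simp

definition N_out :: "'c \<Rightarrow> 'b measure" where
  "N_out z = N z \<bind> (\<lambda>x. K (x, z))"

lemma N_out [measurable]: "N_out \<in> borel \<rightarrow>\<^sub>M prob_algebra borel"
  unfolding N_out_def by measurable

lemma emeasure_N_out:
  assumes [measurable]: "A \<in> sets borel"
  shows "emeasure (N_out z) A = (\<integral>\<^sup>+x. emeasure (K (x, z)) A \<partial>N z)"
  unfolding N_out_def
  by (subst emeasure_bind[where N = borel]) (auto simp: prob_space.not_empty[OF prob_space_N] cong: measurable_cong_sets)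

lemma is_cond_law_first: "is_cond_law T borel borel (\<lambda>(x, y, z). x) (\<lambda>(x, y, z). z) N"
  unfolding is_cond_law_def distr_T_third
proof (intro conjI ballI)
  fix A :: "'a set" and C :: "'c set" assume [measurable]: "A \<in> sets borel" "C \<in> sets borel"
  have "emeasure T {p \<in> space T. (case p of (x, y, z) \<Rightarrow> x) \<in> A \<and> (case p of (x, y, z) \<Rightarrow> z) \<in> C}
    = emeasure T (A \<times> UNIV \<times> C)"
    by (intro arg_cong[where f = "emeasure T"]) auto
  also have "\<dots> = (\<integral>\<^sup>+z. (\<integral>\<^sup>+x. (\<integral>\<^sup>+y. indicator A x * indicator C z \<partial>K (x, z)) \<partial>N z) \<partial>R)"
    by (subst emeasure_T) (auto simp: indicator_times mult_ac)
  also have "\<dots> = (\<integral>\<^sup>+z\<in>C. emeasure (N z) A \<partial>R)"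
    using prob_space.emeasure_space_1[OF prob_space_K] by (simp add: nn_integral_multc)
  finally show "emeasure T {p \<in> space T. (case p of (x, y, z) \<Rightarrow> x) \<in> A \<and> (case p of (x, y, z) \<Rightarrow> z) \<in> C}
    = (\<integral>\<^sup>+z\<in>C. emeasure (N z) A \<partial>R)" .
qed simp

lemma is_cond_law_second: "is_cond_law T borel borel (\<lambda>(x, y, z). y) (\<lambda>(x, y, z). z) N_out"
  unfolding is_cond_law_def distr_T_third
proof (intro conjI ballI)
  fix A :: "'b set" and C :: "'c set" assume [measurable]: "A \<in> sets borel" "C \<in> sets borel"
  have "emeasure T {p \<in> space T. (case p of (x, y, z) \<Rightarrow> y) \<in> A \<and> (case p of (x, y, z) \<Rightarrow> z) \<in> C}
    = emeasure T (UNIV \<times> A \<times> C)"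
    by (intro arg_cong[where f = "emeasure T"]) auto
  also have "\<dots> = (\<integral>\<^sup>+z. (\<integral>\<^sup>+x. (\<integral>\<^sup>+y. indicator A y * indicator C z \<partial>K (x, z)) \<partial>N z) \<partial>R)"
    by (subst emeasure_T) (auto simp: indicator_times mult_ac)
  also have "\<dots> = (\<integral>\<^sup>+z\<in>C. emeasure (N_out z) A \<partial>R)"
  proof (intro nn_integral_cong)
    fix z
    have [measurable]: "(\<lambda>x. emeasure (K (x, z)) A) \<in> borel_measurable (N z)"
      by (simp cong: measurable_cong_sets)
    show "(\<integral>\<^sup>+x. (\<integral>\<^sup>+y. indicator A y * indicator C z \<partial>K (x, z)) \<partial>N z) = emeasure (N_out z) A * indicator C z"
      by (cases "z \<in> C") (simp_all add: emeasure_N_out)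
  qed
  finally show "emeasure T {p \<in> space T. (case p of (x, y, z) \<Rightarrow> y) \<in> A \<and> (case p of (x, y, z) \<Rightarrow> z) \<in> C}
    = (\<integral>\<^sup>+z\<in>C. emeasure (N_out z) A \<partial>R)" .
qed simp

text \<open>\<open>T\<close> and \<open>S\<close> are \<open>P\<close> and \<open>Q\<close> of the introduction.\<close>

abbreviation "S \<equiv> joint_law R N (\<lambda>(x, z). N_out z)"

lemma kernel_chain_S: "kernel_chain R N (\<lambda>(x, z). N_out z)"
  by standard (auto simp: R)

text \<open>The conditional laws chosen inside \<open>cond_mutual_info\<close> agree with
  \<open>N\<close> and \<open>N_out\<close> outside a null set of \<open>R\<close>. The outermost
  integral of the product law runs over z against \<open>R\<close>, so replacing them does not
  change it.\<close>

lemma cond_mutual_info_T: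
  "cond_mutual_info b T borel borel borel (\<lambda>(x, y, z). x) (\<lambda>(x, y, z). y) (\<lambda>(x, y, z). z)
    = KL_divergence_ext b S T"
proof -
  let ?X = "\<lambda>(x, y, z). x" and ?Y = "\<lambda>(x, y, z). y" and ?Z = "\<lambda>(x, y, z). z"
  let ?N = "cond_law T borel borel ?X ?Z" and ?M = "cond_law T borel borel ?Y ?Z"
  interpret S: kernel_chain R N "\<lambda>(x, z). N_out z" by (rule kernel_chain_S)
  have [measurable]: "?Z \<in> T \<rightarrow>\<^sub>M borel" by (simp add: case_prod_unfold)
  have N: "is_cond_law T borel borel ?X ?Z ?N" "AE z in R. ?N z = N z"
    using is_cond_law_cond_law[OF is_cond_law_first]
      is_cond_law_unique[OF T.prob_space_axioms _ is_cond_law_cond_law[OF is_cond_law_first] is_cond_law_first]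
    unfolding distr_T_third by auto
  have M: "is_cond_law T borel borel ?Y ?Z ?M" "AE z in R. ?M z = N_out z"
    using is_cond_law_cond_law[OF is_cond_law_second]
      is_cond_law_unique[OF T.prob_space_axioms _ is_cond_law_cond_law[OF is_cond_law_second] is_cond_law_second]
    unfolding distr_T_third by auto
  have [measurable]: "?N \<in> borel \<rightarrow>\<^sub>M prob_algebra borel" "?M \<in> borel \<rightarrow>\<^sub>M prob_algebra borel"
    using N(1) M(1) by (auto simp: is_cond_law_def)
  interpret C: kernel_chain R ?N "\<lambda>(x, z). ?M z"
    by standard (auto simp: R)
  have "cond_product_law T borel borel borel ?X ?Y ?Z = C.T"
    unfolding cond_product_law_def distr_T_third by (simp add: joint_law_def[of _ ?N])
  also have "C.T = S"
  proof (rule measure_eqI)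
    fix A assume "A \<in> sets C.T"
    then have "A \<in> sets (borel \<Otimes>\<^sub>M borel \<Otimes>\<^sub>M borel)" by simp
    then show "emeasure C.T A = emeasure S A"
      unfolding C.emeasure_T[OF \<open>A \<in> sets (borel \<Otimes>\<^sub>M borel \<Otimes>\<^sub>M borel)\<close>] S.emeasure_T[OF \<open>A \<in> sets (borel \<Otimes>\<^sub>M borel \<Otimes>\<^sub>M borel)\<close>]
      using N(2) M(2) by (intro nn_integral_cong_AE) auto
  qed simp
  finally have prod: "cond_product_law T borel borel borel ?X ?Y ?Z = S" .
  have "distr T (borel \<Otimes>\<^sub>M borel \<Otimes>\<^sub>M borel) (\<lambda>w. (?X w, ?Y w, ?Z w)) = T"
    by (simp add: case_prod_unfold distr_id2)
  with prod show ?thesis by (simp add: cond_mutual_info_def)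
qed

end

text \<open>\<open>quantizer_law\<close> starts from the joint law of (x, z), whereas
  \<open>joint_law\<close> draws z before x. Associativity of bind reconciles the two once the law
  of (x, z) is disintegrated along z.\<close>

lemma quantizer_law_eq_joint_law:
  fixes R :: "'a::euclidean_space measure" and N :: "'a \<Rightarrow> 'a measure"
  assumes "kernel_chain R N K"
  shows "quantizer_law (R \<bind> (\<lambda>z. N z \<bind> (\<lambda>x. return (borel \<Otimes>\<^sub>M borel) (x, z)))) K = joint_law R N K"
proof -
  interpret kernel_chain R N K by fact
  let ?ret = "return (borel \<Otimes>\<^sub>M borel \<Otimes>\<^sub>M borel)" and ?ret2 = "return (borel \<Otimes>\<^sub>M borel)"
  let ?g = "\<lambda>(x, z). K (x, z) \<bind> (\<lambda>y. ?ret (x, y, z))"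
  have g: "?g \<in> borel \<Otimes>\<^sub>M borel \<rightarrow>\<^sub>M prob_algebra (borel \<Otimes>\<^sub>M borel \<Otimes>\<^sub>M borel)" by measurable
  note g' = measurable_prob_algebraD[OF g]
  have 1: "(\<lambda>z. N z \<bind> (\<lambda>x. ?ret2 (x, z))) \<in> borel \<rightarrow>\<^sub>M prob_algebra (borel \<Otimes>\<^sub>M borel)" by measurable
  have 2: "(\<lambda>x. ?ret2 (x, z)) \<in> borel \<rightarrow>\<^sub>M prob_algebra (borel \<Otimes>\<^sub>M borel)" for z by measurable
  have q1: "quantizer_law (R \<bind> (\<lambda>z. N z \<bind> (\<lambda>x. ?ret2 (x, z)))) K = R \<bind> (\<lambda>z. (N z \<bind> (\<lambda>x. ?ret2 (x, z))) \<bind> ?g)"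
    unfolding quantizer_law_def
    by (rule bind_assoc[OF _ g']) (use measurable_prob_algebraD[OF 1] in \<open>auto cong: measurable_cong_sets\<close>)
  have q2: "(N z \<bind> (\<lambda>x. ?ret2 (x, z))) \<bind> ?g = N z \<bind> (\<lambda>x. ?ret2 (x, z) \<bind> ?g)" for z
    by (rule bind_assoc[OF _ g']) (use measurable_prob_algebraD[OF 2] in \<open>auto cong: measurable_cong_sets\<close>)
  have q3: "?ret2 (x, z) \<bind> ?g = ?g (x, z)" for x z
    by (subst bind_return[OF g']) (auto simp: space_pair_measure)
  show ?thesis
    unfolding q1 q2 q3 joint_law_def by simp
qed

section \<open>The Gaussian rate-distortion function with side information\<close>

lemma measurable_gauss_shift:
  assumes [measurable]: "m \<in> R \<rightarrow>\<^sub>M borel" and "v \<ge> 0"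
  shows "(\<lambda>p. distr (gauss v) borel (\<lambda>u::'a::euclidean_space. m p + u)) \<in> R \<rightarrow>\<^sub>M prob_algebra borel"
proof -
  have [measurable]: "(\<lambda>_. gauss v :: 'a measure) \<in> R \<rightarrow>\<^sub>M prob_algebra borel"
    using prob_space_gauss[OF assms(2)] by (intro measurable_const) (simp add: space_prob_algebra)
  show ?thesis by measurable
qed

lemma nn_integral_gauss_shift':
  fixes f :: "'a::euclidean_space \<Rightarrow> ennreal"
  assumes [measurable]: "f \<in> borel_measurable borel" and "v > 0"
  shows "(\<integral>\<^sup>+x. f x \<partial>distr (gauss v) borel (\<lambda>u. m + u)) = (\<integral>\<^sup>+x. ennreal (gauss_density v (x - m)) * f x \<partial>lborel)"
  using nn_integral_gauss_shift[OF assms] by (subst nn_integral_distr) auto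

lemma ln_gauss_density:
  fixes x :: "'a::euclidean_space"
  assumes "v > 0"
  shows "ln (gauss_density v x) = - (norm x)\<^sup>2 / v - DIM('a) / 2 * ln (pi * v)"
  using assms by (simp add: gauss_density_def ln_div ln_realpow ln_sqrt)

lemma nn_integral_gauss_shift_norm_square:
  fixes m :: "'a::euclidean_space"
  assumes "v > 0"
  shows "(\<integral>\<^sup>+x. ennreal ((norm (x - m))\<^sup>2) \<partial>distr (gauss v) borel (\<lambda>u. m + u)) = ennreal (DIM('a) / 2 * v)"
  using nn_integral_gauss_norm_square[OF assms, where 'a = 'a] by (subst nn_integral_distr) auto

section \<open>Converse: a lower bound for every admissible quantizer\<close>

definition source :: "real \<Rightarrow> real \<Rightarrow> 'a::euclidean_space \<Rightarrow> 'a measure" where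
  "source c v z = distr (gauss v) borel (\<lambda>u. c *\<^sub>R z + u)"

text \<open>The test function f of the overview, in natural logarithms; base 2 enters only with the
  division by \<open>ln 2\<close>.\<close>

definition log_density_ratio :: "real \<Rightarrow> real \<Rightarrow> real \<Rightarrow> 'a::euclidean_space \<times> 'a \<times> 'a \<Rightarrow> real" where
  "log_density_ratio c v d = (\<lambda>(x, y, z). ln (gauss_density d (x - y)) - ln (gauss_density v (x - c *\<^sub>R z)))"

lemma log_density_ratio_measurable [measurable]:
  "log_density_ratio c v d \<in> borel_measurable (borel \<Otimes>\<^sub>M borel \<Otimes>\<^sub>M borel)"
  unfolding log_density_ratio_def by measurable

lemma exp_log_density_ratio:
  assumes "v > 0" "d > 0"
  shows "exp (log_density_ratio c v d (x, y, z)) = gauss_density d (x - y) / gauss_density v (x - c *\<^sub>R z)"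
  using assms by (simp add: log_density_ratio_def exp_diff gauss_density_pos)

text \<open>The norms enter squared, so the mean of this function is fixed by two second moments:
  the distortion and the source variance. This is why a bound on the mean distortion suffices for
  the converse.\<close>

lemma log_density_ratio_eq:
  fixes x y z :: "'a::euclidean_space"
  assumes "v > 0" "d > 0"
  shows "log_density_ratio c v d (x, y, z) = DIM('a) / 2 * ln (v / d) - (norm (x - y))\<^sup>2 / d + (norm (x - c *\<^sub>R z))\<^sup>2 / v"
  using assms by (simp add: log_density_ratio_def ln_gauss_density ln_mult ln_div field_simps)

locale gaussian_source =
  fixes R :: "'a::euclidean_space measure" and c v :: real and K :: "'a \<times> 'a \<Rightarrow> 'a measure"
  assumes R: "R \<in> space (prob_algebra borel)" and v: "v > 0"
    and K: "K \<in> borel \<Otimes>\<^sub>M borel \<rightarrow>\<^sub>M prob_algebra borel"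
begin

sublocale kernel_chain R "source c v" K
proof
  show "source c v \<in> borel \<rightarrow>\<^sub>M prob_algebra borel"
    unfolding source_def[abs_def] using v by (intro measurable_gauss_shift) auto
qed (fact R K)+

sublocale S: kernel_chain R "source c v" "\<lambda>(x, z). N_out z"
  by (rule kernel_chain_S)

lemma nn_integral_T_source:
  "(\<integral>\<^sup>+(x, y, z). ennreal ((norm (x - c *\<^sub>R z))\<^sup>2) \<partial>T) = ennreal (DIM('a) / 2 * v)"
proof -
  have "(\<integral>\<^sup>+(x, y, z). ennreal ((norm (x - c *\<^sub>R z))\<^sup>2) \<partial>T)
      = (\<integral>\<^sup>+z. (\<integral>\<^sup>+x. ennreal ((norm (x - c *\<^sub>R z))\<^sup>2) \<partial>source c v z) \<partial>R)"
    using prob_space.emeasure_space_1[OF prob_space_K] by (subst nn_integral_T) auto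
  also have "\<dots> = ennreal (DIM('a) / 2 * v)"
    using R.emeasure_space_1 by (simp add: source_def nn_integral_gauss_shift_norm_square v)
  finally show ?thesis .
qed

text \<open>Under \<open>S\<close> the variable x is independent of y given z, so it can be
  integrated before y. The source density then cancels against the denominator of the ratio, leaving
  the Gaussian density of variance d centred at y.\<close>

lemma nn_integral_S_log_density_ratio:
  assumes d: "d > 0"
  shows "(\<integral>\<^sup>+p. ennreal (exp (log_density_ratio c v d p)) \<partial>S) = 1"
proof -
  have inner: "(\<integral>\<^sup>+x. (\<integral>\<^sup>+y. ennreal (exp (log_density_ratio c v d (x, y, z))) \<partial>N_out z) \<partial>source c v z) = 1" for z
  proof -
    interpret N: prob_space "source c v z" by (rule prob_space_N)
    interpret O: prob_space "N_out z" using S.prob_space_K[of "(_, z)"] by simp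
    interpret NO: pair_sigma_finite "source c v z" "N_out z" ..
    have [measurable_cong]: "sets (N_out z) = sets borel" "sets (source c v z) = sets borel"
      using S.sets_K[of "(_, z)"] by auto
    have "(\<integral>\<^sup>+x. ennreal (exp (log_density_ratio c v d (x, y, z))) \<partial>source c v z) = 1" for y
    proof -
      have "(\<integral>\<^sup>+x. ennreal (exp (log_density_ratio c v d (x, y, z))) \<partial>source c v z)
          = (\<integral>\<^sup>+x. ennreal (gauss_density v (x - c *\<^sub>R z)) * ennreal (exp (log_density_ratio c v d (x, y, z))) \<partial>lborel)"
        unfolding source_def by (rule nn_integral_gauss_shift') (use v in auto)
      also have "\<dots> = (\<integral>\<^sup>+x. ennreal (gauss_density d (x - y)) \<partial>lborel)"
      proof (intro nn_integral_cong)
        fix x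
        have "gauss_density v (x - c *\<^sub>R z) * exp (log_density_ratio c v d (x, y, z)) = gauss_density d (x - y)"
          using gauss_density_pos[OF v, of "x - c *\<^sub>R z"] by (simp add: exp_log_density_ratio v d)
        then show "ennreal (gauss_density v (x - c *\<^sub>R z)) * ennreal (exp (log_density_ratio c v d (x, y, z))) = ennreal (gauss_density d (x - y))"
          by (simp add: ennreal_mult'[symmetric] gauss_density_nonneg v)
      qed
      finally show ?thesis by (simp add: nn_integral_gauss_density_shift d)
    qed
    then have "(\<integral>\<^sup>+y. (\<integral>\<^sup>+x. ennreal (exp (log_density_ratio c v d (x, y, z))) \<partial>source c v z) \<partial>N_out z) = 1"
      using O.emeasure_space_1 by simp
    then show ?thesis
      by (subst (asm) NO.Fubini') auto
  qed
  show ?thesis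
    using R.emeasure_space_1 by (subst S.nn_integral_T) (auto simp: inner)
qed

text \<open>The mean squared norm of x - c z is \<open>DIM('a) / 2 * v\<close> whatever the
  quantizer, so the last quadratic term contributes exactly \<open>DIM('a) / 2\<close>. Finite
  distortion makes the other quadratic term integrable.\<close>

lemma
  assumes d: "d > 0" and dist: "(\<integral>\<^sup>+(x, y, z). ennreal ((norm (x - y))\<^sup>2) \<partial>T) \<le> ennreal D"
  shows integrable_log_density_ratio: "integrable T (log_density_ratio c v d)"
    and integral_log_density_ratio: "(\<integral>p. log_density_ratio c v d p \<partial>T) =
      DIM('a) / 2 * ln (v / d) - (\<integral>(x, y, z). (norm (x - y))\<^sup>2 \<partial>T) / d + DIM('a) / 2"
    and integral_distortion_le: "D \<ge> 0 \<Longrightarrow> (\<integral>(x, y, z). (norm (x - y))\<^sup>2 \<partial>T) \<le> D"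
proof -
  have i1: "integrable T (\<lambda>(x, y, z). (norm (x - y))\<^sup>2)"
    using order.strict_trans1[OF dist, of top] by (intro integrableI_bounded) (auto simp: case_prod_unfold)
  have i2: "integrable T (\<lambda>(x, y, z). (norm (x - c *\<^sub>R z))\<^sup>2)"
    using nn_integral_T_source by (intro integrableI_bounded) (auto simp: case_prod_unfold)
  have "ennreal (\<integral>(x, y, z). (norm (x - c *\<^sub>R z))\<^sup>2 \<partial>T) = ennreal (DIM('a) / 2 * v)"
    using nn_integral_T_source i2 by (subst nn_integral_eq_integral[symmetric]) (auto simp: case_prod_unfold)
  hence 2: "(\<integral>(x, y, z). (norm (x - c *\<^sub>R z))\<^sup>2 \<partial>T) = DIM('a) / 2 * v"
    using v by (subst (asm) ennreal_inj) (auto intro!: integral_nonneg_AE)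
  have eq: "log_density_ratio c v d = (\<lambda>p :: 'a \<times> 'a \<times> 'a. (DIM('a) / 2 * ln (v / d) - (case p of (x, y, z) \<Rightarrow> (norm (x - y))\<^sup>2) / d)
      + (case p of (x, y, z) \<Rightarrow> (norm (x - c *\<^sub>R z))\<^sup>2) / v)"
    using v d by (simp add: fun_eq_iff log_density_ratio_eq)
  show "integrable T (log_density_ratio c v d)"
    unfolding eq using i1 i2 by (intro Bochner_Integration.integrable_add Bochner_Integration.integrable_diff integrable_divide) auto
  show "(\<integral>p. log_density_ratio c v d p \<partial>T) =
      DIM('a) / 2 * ln (v / d) - (\<integral>(x, y, z). (norm (x - y))\<^sup>2 \<partial>T) / d + DIM('a) / 2"
    unfolding eq using i1 i2 v 2 by (simp add: T.prob_space[unfolded space_T])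
  show "(\<integral>(x, y, z). (norm (x - y))\<^sup>2 \<partial>T) \<le> D" if "D \<ge> 0"
  proof -
    have "ennreal (\<integral>(x, y, z). (norm (x - y))\<^sup>2 \<partial>T) \<le> ennreal D"
      using dist i1 by (subst nn_integral_eq_integral[symmetric]) (auto simp: case_prod_unfold)
    then show ?thesis using that by simp
  qed
qed

lemma KL_ge:
  assumes d: "d > 0" and dist: "(\<integral>\<^sup>+(x, y, z). ennreal ((norm (x - y))\<^sup>2) \<partial>T) \<le> ennreal (DIM('a) / 2 * d)"
  shows "ereal (DIM('a) / 2 * max (log 2 (v / d)) 0) \<le> KL_divergence_ext 2 S T"
proof -
  have "(\<integral>(x, y, z). (norm (x - y))\<^sup>2 \<partial>T) / d \<le> DIM('a) / 2"
    using integral_distortion_le[OF d dist] d by (simp add: field_simps)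
  \<comment> \<open>The distortion term is at most the \<open>DIM('a) / 2\<close> contributed by the
    source, so the logarithm bounds the mean from below.\<close>
  hence "DIM('a) / 2 * ln (v / d) \<le> (\<integral>p. log_density_ratio c v d p \<partial>T)"
    unfolding integral_log_density_ratio[OF d dist] by simp
  hence "DIM('a) / 2 * ln (v / d) / ln 2 \<le> (\<integral>p. log_density_ratio c v d p \<partial>T) / ln 2"
    by (intro divide_right_mono) auto
  hence "ereal (DIM('a) / 2 * log 2 (v / d)) \<le> ereal ((\<integral>p. log_density_ratio c v d p \<partial>T) / ln 2)"
    by (simp add: log_def)
  also have "\<dots> \<le> KL_divergence_ext 2 S T"
    using integrable_log_density_ratio[OF d dist] nn_integral_S_log_density_ratio[OF d]
    by (intro KL_divergence_ext_ge S.T.prob_space_axioms T.prob_space_axioms) (auto cong: measurable_cong_sets)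
  finally have 1: "ereal (DIM('a) / 2 * log 2 (v / d)) \<le> KL_divergence_ext 2 S T" .
  \<comment> \<open>The test function 0 gives nonnegativity of the divergence, hence the 0 in the
    maximum.\<close>
  have "ereal ((\<integral>p. 0 \<partial>T) / ln 2) \<le> KL_divergence_ext 2 S T"
    using S.T.emeasure_space_1
    by (intro KL_divergence_ext_ge S.T.prob_space_axioms T.prob_space_axioms) auto
  with 1 show ?thesis by (simp add: max_def)
qed

end

section \<open>Achievability: quantizers that attain the bound\<close>

lemma (in gaussian_source) distortion_const:
  assumes "K = (\<lambda>(x, z). return borel (c *\<^sub>R z))"
  shows "(\<integral>\<^sup>+(x, y, z). ennreal ((norm (x - y))\<^sup>2) \<partial>T) = ennreal (DIM('a) / 2 * v)"
    and "KL_divergence_ext 2 S T = 0"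
proof -
  have k: "K (x, z) = return borel (c *\<^sub>R z)" for x z by (simp add: assms)
  have "(\<integral>\<^sup>+(x, y, z). ennreal ((norm (x - y))\<^sup>2) \<partial>T) = (\<integral>\<^sup>+(x, y, z). ennreal ((norm (x - c *\<^sub>R z))\<^sup>2) \<partial>T)"
    by (simp add: nn_integral_T case_prod_unfold k nn_integral_return)
  then show "(\<integral>\<^sup>+(x, y, z). ennreal ((norm (x - y))\<^sup>2) \<partial>T) = ennreal (DIM('a) / 2 * v)"
    by (simp add: nn_integral_T_source)
  \<comment> \<open>The output is a function of z alone, so averaging over x leaves the kernel
    unchanged and the joint law is already the conditionally independent one.\<close>
  have "N_out z = return borel (c *\<^sub>R z)" for z
    unfolding N_out_def k
    by (simp add: bind_const' prob_space_N prob_space_return prob_space_imp_subprob_space)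
  hence ST: "S = T" by (simp add: joint_law_def k)
  have "T = density T (\<lambda>x. ennreal (exp 0))" by (simp add: density_1)
  from KL_divergence_ext_density_exp[OF T.prob_space_axioms _ this, of 2]
  show "KL_divergence_ext 2 S T = 0" unfolding ST by simp
qed

text \<open>The optimal test channel: given \<open>z\<close>, \<open>y\<close> is \<open>c z\<close> plus \<open>gauss (v - d)\<close> and \<open>x\<close> is \<open>y\<close> plus an
  independent \<open>gauss d\<close>. The kernel below is the resulting law of \<open>y\<close> given \<open>(x, z)\<close>.\<close>

definition test_channel :: "real \<Rightarrow> real \<Rightarrow> real \<Rightarrow> 'a::euclidean_space \<times> 'a \<Rightarrow> 'a measure" where
  "test_channel c v d = (\<lambda>(x, z). distr (gauss ((v - d) * d / v)) borel
     (\<lambda>u. (c *\<^sub>R z + ((v - d) / v) *\<^sub>R (x - c *\<^sub>R z)) + u))"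

lemma test_channel_measurable:
  assumes "0 < d" "d < v"
  shows "test_channel c v d \<in> borel \<Otimes>\<^sub>M borel \<rightarrow>\<^sub>M prob_algebra borel"
  unfolding test_channel_def case_prod_unfold using assms
  by (intro measurable_gauss_shift) auto

text \<open>Bayes' factorization with y - c z as signal of variance v - d, noise of variance d and
  observation x - c z. It is the origin of the gain \<open>(v - d) / v\<close> and of the residual
  variance \<open>(v - d) * d / v\<close> in \<open>test_channel\<close>.\<close>

lemma gauss_density_test_channel:
  assumes "0 < d" "d < v"
  shows "gauss_density v (x - c *\<^sub>R z) * gauss_density ((v - d) * d / v) (y - (c *\<^sub>R z + ((v - d) / v) *\<^sub>R (x - c *\<^sub>R z)))
    = gauss_density (v - d) (y - c *\<^sub>R z) * gauss_density d (x - y)"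
  using gauss_density_bayes[of "v - d" d "y - c *\<^sub>R z" "x - c *\<^sub>R z"] assms
  by (simp add: diff_diff_eq)

locale gaussian_test_channel =
  fixes R :: "'a::euclidean_space measure" and c v d :: real
  assumes R: "R \<in> space (prob_algebra borel)" and d: "0 < d" and dv: "d < v"
begin

sublocale gaussian_source R c v "test_channel c v d"
  using R d dv test_channel_measurable by unfold_locales auto

lemma s_pos: "(v - d) * d / v > 0" "v - d > 0"
  using d dv by auto

lemma nn_integral_test_channel:
  assumes [measurable]: "case_prod f \<in> borel_measurable (borel \<Otimes>\<^sub>M borel)"
  shows "(\<integral>\<^sup>+x. (\<integral>\<^sup>+y. f x y \<partial>test_channel c v d (x, z)) \<partial>source c v z)
    = (\<integral>\<^sup>+x. (\<integral>\<^sup>+y. ennreal (gauss_density (v - d) (y - c *\<^sub>R z) * gauss_density d (x - y)) * f x y \<partial>lborel) \<partial>lborel)"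
proof -
  let ?m = "\<lambda>x. c *\<^sub>R z + ((v - d) / v) *\<^sub>R (x - c *\<^sub>R z)"
  have [measurable]: "f x \<in> borel_measurable borel" for x
    using measurable_compose[OF measurable_Pair1'[of x borel borel] assms] by simp
  have f: "(\<integral>\<^sup>+y. f x y \<partial>test_channel c v d (x, z)) = (\<integral>\<^sup>+y. ennreal (gauss_density ((v - d) * d / v) (y - ?m x)) * f x y \<partial>lborel)" for x
    unfolding test_channel_def prod.case by (rule nn_integral_gauss_shift') (use s_pos in auto)
  have "(\<integral>\<^sup>+x. (\<integral>\<^sup>+y. f x y \<partial>test_channel c v d (x, z)) \<partial>source c v z)
      = (\<integral>\<^sup>+x. ennreal (gauss_density v (x - c *\<^sub>R z)) * (\<integral>\<^sup>+y. ennreal (gauss_density ((v - d) * d / v) (y - ?m x)) * f x y \<partial>lborel) \<partial>lborel)"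
    unfolding f source_def by (rule nn_integral_gauss_shift') (use v in auto)
  also have "\<dots> = (\<integral>\<^sup>+x. (\<integral>\<^sup>+y. ennreal (gauss_density v (x - c *\<^sub>R z) * gauss_density ((v - d) * d / v) (y - ?m x)) * f x y \<partial>lborel) \<partial>lborel)"
    by (simp add: nn_integral_cmult[symmetric] ennreal_mult' gauss_density_nonneg v mult.assoc)
  finally show ?thesis
    unfolding gauss_density_test_channel[OF d dv] .
qed

text \<open>Reversal of the channel: y is drawn around c z and x around y afterwards. In this order
  the error x - y and the marginal law of y can be read off directly.\<close>

lemma nn_integral_test_channel_swap:
  assumes [measurable]: "case_prod f \<in> borel_measurable (borel \<Otimes>\<^sub>M borel)"
  shows "(\<integral>\<^sup>+x. (\<integral>\<^sup>+y. f x y \<partial>test_channel c v d (x, z)) \<partial>source c v z)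
    = (\<integral>\<^sup>+y. (\<integral>\<^sup>+x. f x y \<partial>distr (gauss d) borel (\<lambda>u. y + u)) \<partial>source c (v - d) z)"
proof -
  have [measurable]: "(\<lambda>x. f x y) \<in> borel_measurable borel" for y
    using measurable_compose[OF measurable_Pair2'[of y borel borel] assms] by simp
  have f: "(\<integral>\<^sup>+x. f x y \<partial>distr (gauss d) borel (\<lambda>u. y + u)) = (\<integral>\<^sup>+x. ennreal (gauss_density d (x - y)) * f x y \<partial>lborel)" for y
    by (rule nn_integral_gauss_shift') (use d in auto)
  have "(\<integral>\<^sup>+x. (\<integral>\<^sup>+y. f x y \<partial>test_channel c v d (x, z)) \<partial>source c v z)
     = (\<integral>\<^sup>+y. (\<integral>\<^sup>+x. ennreal (gauss_density (v - d) (y - c *\<^sub>R z) * gauss_density d (x - y)) * f x y \<partial>lborel) \<partial>lborel)"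
    unfolding nn_integral_test_channel[OF assms] by (rule lborel_pair.Fubini') (simp add: case_prod_unfold)
  also have "\<dots> = (\<integral>\<^sup>+y. ennreal (gauss_density (v - d) (y - c *\<^sub>R z)) * (\<integral>\<^sup>+x. ennreal (gauss_density d (x - y)) * f x y \<partial>lborel) \<partial>lborel)"
    by (simp add: nn_integral_cmult[symmetric] ennreal_mult' gauss_density_nonneg dv mult.assoc)
  also have "\<dots> = (\<integral>\<^sup>+y. (\<integral>\<^sup>+x. f x y \<partial>distr (gauss d) borel (\<lambda>u. y + u)) \<partial>source c (v - d) z)"
    unfolding f source_def by (rule nn_integral_gauss_shift'[symmetric]) (use s_pos in auto)
  finally show ?thesis .
qed

lemma distortion_T: "(\<integral>\<^sup>+(x, y, z). ennreal ((norm (x - y))\<^sup>2) \<partial>T) = ennreal (DIM('a) / 2 * d)"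
proof -
  interpret G: prob_space "gauss (v - d) :: 'a measure" using dv by (intro prob_space_gauss) simp
  have p: "prob_space (source c (v - d) z)" for z :: 'a
    unfolding source_def by (rule G.prob_space_distr) simp
  have "(\<integral>\<^sup>+x. (\<integral>\<^sup>+y. ennreal ((norm (x - y))\<^sup>2) \<partial>test_channel c v d (x, z)) \<partial>source c v z) = ennreal (DIM('a) / 2 * d)" for z :: 'a
    using prob_space.emeasure_space_1[OF p]
    by (subst nn_integral_test_channel_swap) (auto simp: nn_integral_gauss_shift_norm_square d)
  then show ?thesis
    using R.emeasure_space_1 by (subst nn_integral_T) auto
qed

lemma N_out_eq: "N_out z = source c (v - d) z"
proof (rule measure_eqI)
  show sets: "sets (N_out z) = sets (source c (v - d) z)"
    using S.sets_K[of "(_, z)"] by (simp add: source_def)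
  fix A assume "A \<in> sets (N_out z)"
  then have A [measurable]: "A \<in> sets borel" using sets by (simp add: source_def)
  have "emeasure (N_out z) A = (\<integral>\<^sup>+x. (\<integral>\<^sup>+y. indicator A y \<partial>test_channel c v d (x, z)) \<partial>source c v z)"
    by (simp add: emeasure_N_out)
  also have "\<dots> = (\<integral>\<^sup>+y. indicator A y \<partial>source c (v - d) z)"
  proof -
    have "emeasure (distr (gauss d) borel (\<lambda>u::'a. y + u)) UNIV = 1" for y
      using prob_space.emeasure_space_1[OF prob_space_gauss[of d, where 'a = 'a]] d by (simp add: emeasure_distr)
    then show ?thesis by (subst nn_integral_test_channel_swap) auto
  qed
  finally show "emeasure (N_out z) A = emeasure (source c (v - d) z) A"
    by (simp add: source_def)
qed

text \<open>For fixed z both laws have Lebesgue densities in (x, y): source density times output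
  density for \<open>S\<close>, and output density times the Gaussian density of variance d at x - y
  for \<open>T\<close>. Their quotient is the exponential of the test function.\<close>

lemma T_eq_density: "T = density S (\<lambda>p. ennreal (exp (log_density_ratio c v d p)))"
proof (rule measure_eqI)
  fix A assume "A \<in> sets T"
  then have A [measurable]: "A \<in> sets (borel \<Otimes>\<^sub>M borel \<Otimes>\<^sub>M borel)" by simp
  have [measurable]: "log_density_ratio c v d \<in> borel_measurable S" by (simp cong: measurable_cong_sets)
  have e: "(\<integral>\<^sup>+x. (\<integral>\<^sup>+y. indicator A (x, y, z) \<partial>test_channel c v d (x, z)) \<partial>source c v z)
    = (\<integral>\<^sup>+x. (\<integral>\<^sup>+y. ennreal (exp (log_density_ratio c v d (x, y, z))) * indicator A (x, y, z) \<partial>N_out z) \<partial>source c v z)" for z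
  proof -
    let ?g = "\<lambda>x y. ennreal (exp (log_density_ratio c v d (x, y, z))) * indicator A (x, y, z)"
    have g: "(\<integral>\<^sup>+y. ?g x y \<partial>N_out z) = (\<integral>\<^sup>+y. ennreal (gauss_density (v - d) (y - c *\<^sub>R z)) * ?g x y \<partial>lborel)" for x
      unfolding N_out_eq source_def by (rule nn_integral_gauss_shift') (use s_pos in auto)
    have "(\<integral>\<^sup>+x. (\<integral>\<^sup>+y. ?g x y \<partial>N_out z) \<partial>source c v z)
      = (\<integral>\<^sup>+x. ennreal (gauss_density v (x - c *\<^sub>R z)) * (\<integral>\<^sup>+y. ennreal (gauss_density (v - d) (y - c *\<^sub>R z)) * ?g x y \<partial>lborel) \<partial>lborel)"
      unfolding g source_def by (rule nn_integral_gauss_shift') (use v in auto)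
    also have "\<dots> = (\<integral>\<^sup>+x. (\<integral>\<^sup>+y. ennreal (gauss_density v (x - c *\<^sub>R z)) * (ennreal (gauss_density (v - d) (y - c *\<^sub>R z)) * ?g x y) \<partial>lborel) \<partial>lborel)"
      by (simp add: nn_integral_cmult)
    also have "\<dots> = (\<integral>\<^sup>+x. (\<integral>\<^sup>+y. ennreal (gauss_density (v - d) (y - c *\<^sub>R z) * gauss_density d (x - y)) * indicator A (x, y, z) \<partial>lborel) \<partial>lborel)"
    proof (intro nn_integral_cong)
      fix x y :: 'a
      have "gauss_density v (x - c *\<^sub>R z) * (gauss_density (v - d) (y - c *\<^sub>R z) * exp (log_density_ratio c v d (x, y, z)))
        = gauss_density (v - d) (y - c *\<^sub>R z) * gauss_density d (x - y)"
        using gauss_density_pos[OF v, of "x - c *\<^sub>R z"] by (simp add: exp_log_density_ratio v d)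
      moreover have "ennreal (gauss_density v (x - c *\<^sub>R z)) * (ennreal (gauss_density (v - d) (y - c *\<^sub>R z)) * ?g x y)
        = ennreal (gauss_density v (x - c *\<^sub>R z) * (gauss_density (v - d) (y - c *\<^sub>R z) * exp (log_density_ratio c v d (x, y, z)))) * indicator A (x, y, z)"
        by (simp add: ennreal_mult gauss_density_nonneg v dv mult.assoc)
      ultimately show "ennreal (gauss_density v (x - c *\<^sub>R z)) * (ennreal (gauss_density (v - d) (y - c *\<^sub>R z)) * ?g x y)
        = ennreal (gauss_density (v - d) (y - c *\<^sub>R z) * gauss_density d (x - y)) * indicator A (x, y, z)"
        by (simp only:)
    qed
    also have "\<dots> = (\<integral>\<^sup>+x. (\<integral>\<^sup>+y. indicator A (x, y, z) \<partial>test_channel c v d (x, z)) \<partial>source c v z)"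
      by (rule nn_integral_test_channel[symmetric]) (simp add: case_prod_unfold)
    finally show ?thesis by simp
  qed
  have "emeasure (density S (\<lambda>p. ennreal (exp (log_density_ratio c v d p)))) A = (\<integral>\<^sup>+p. ennreal (exp (log_density_ratio c v d p)) * indicator A p \<partial>S)"
    by (rule emeasure_density) auto
  then show "emeasure T A = emeasure (density S (\<lambda>p. ennreal (exp (log_density_ratio c v d p)))) A"
    by (simp add: emeasure_T S.nn_integral_T e)
qed simp

lemma KL_test_channel: "KL_divergence_ext 2 S T = ereal (DIM('a) / 2 * log 2 (v / d))"
proof -
  have dist: "(\<integral>\<^sup>+(x, y, z). ennreal ((norm (x - y))\<^sup>2) \<partial>T) \<le> ennreal (DIM('a) / 2 * d)"
    by (simp add: distortion_T)
  have int: "integrable T (log_density_ratio c v d)" by (rule integrable_log_density_ratio[OF d dist])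
  have "ennreal (\<integral>(x, y, z). (norm (x - y))\<^sup>2 \<partial>T) = ennreal (DIM('a) / 2 * d)"
    using distortion_T
    by (subst nn_integral_eq_integral[symmetric])
       (auto simp: case_prod_unfold intro!: integrableI_bounded)
  hence "(\<integral>(x, y, z). (norm (x - y))\<^sup>2 \<partial>T) = DIM('a) / 2 * d"
    using d by (subst (asm) ennreal_inj) (auto intro!: integral_nonneg_AE)
  \<comment> \<open>The distortion is exactly \<open>DIM('a) / 2 * d\<close>, so the two constants
    cancel.\<close>
  hence "(\<integral>p. log_density_ratio c v d p \<partial>T) = DIM('a) / 2 * ln (v / d)"
    unfolding integral_log_density_ratio[OF d dist] using d by simp
  moreover have "KL_divergence_ext 2 S T = ereal ((\<integral>p. log_density_ratio c v d p \<partial>T) / ln 2)"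
    using int by (intro KL_divergence_ext_density_exp[OF S.T.prob_space_axioms _ T_eq_density]) (auto cong: measurable_cong_sets)
  ultimately show ?thesis by (simp only: log_def times_divide_eq_right)
qed

end

text \<open>Independence of \<open>Z\<close> and the innovation X - c Z disintegrates the law of the
  pair into the law of \<open>Z\<close> and the kernel \<open>source\<close>. Every admissible
  quantizer then falls under \<open>gaussian_source\<close>, and the infimum turns out to be
  attained.\<close>

lemma min_feedback_rate_gaussian:
  fixes X Z :: "'w \<Rightarrow> 'a::euclidean_space"
  assumes "prob_space M" and X [measurable]: "X \<in> borel_measurable M" and Z [measurable]: "Z \<in> borel_measurable M"
    and ind: "prob_space.indep_var M borel Z borel (\<lambda>w. X w - c *\<^sub>R Z w)"
    and law: "distr M borel (\<lambda>w. X w - c *\<^sub>R Z w) = gauss v"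
    and v: "v > 0" and d: "d > 0"
  shows "min_feedback_rate M X Z (DIM('a) / 2 * d) = ereal (DIM('a) / 2 * max (log 2 (v / d)) 0)"
proof -
  interpret prob_space M by fact
  let ?R = "distr M borel Z" and ?V = "\<lambda>w. X w - c *\<^sub>R Z w"
  let ?L = "distr M (borel \<Otimes>\<^sub>M borel) (\<lambda>w. (X w, Z w))"
  have R: "?R \<in> space (prob_algebra borel)"
    by (simp add: space_prob_algebra prob_space_distr)
  interpret G: prob_space "gauss v :: 'a measure" using v by (intro prob_space_gauss) simp
  have src: "source c v \<in> borel \<rightarrow>\<^sub>M prob_algebra (borel :: 'a measure)"
    unfolding source_def[abs_def] using v by (intro measurable_gauss_shift) auto
  have L: "?L = ?R \<bind> (\<lambda>z. source c v z \<bind> (\<lambda>x. return (borel \<Otimes>\<^sub>M borel) (x, z)))"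
  proof (rule measure_eqI)
    note [measurable] = src
    have k: "(\<lambda>z. source c v z \<bind> (\<lambda>x. return (borel \<Otimes>\<^sub>M borel) (x, z))) \<in> borel \<rightarrow>\<^sub>M prob_algebra (borel \<Otimes>\<^sub>M (borel :: 'a measure))"
      by measurable
    show "sets ?L = sets (?R \<bind> (\<lambda>z. source c v z \<bind> (\<lambda>x. return (borel \<Otimes>\<^sub>M borel) (x, z))))"
      using sets_bind'[OF R k] by simp
    fix A assume "A \<in> sets ?L"
    then have A [measurable]: "A \<in> sets (borel \<Otimes>\<^sub>M borel)" by simp
    have "emeasure ?L A = (\<integral>\<^sup>+w. indicator A (c *\<^sub>R Z w + ?V w, Z w) \<partial>M)"
      by (simp add: nn_integral_indicator[symmetric] nn_integral_distr del: nn_integral_indicator)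
    also have "\<dots> = (\<integral>\<^sup>+p. indicator A (c *\<^sub>R fst p + snd p, fst p) \<partial>distr M (borel \<Otimes>\<^sub>M borel) (\<lambda>w. (Z w, ?V w)))"
      by (subst nn_integral_distr) auto
    also have "distr M (borel \<Otimes>\<^sub>M borel) (\<lambda>w. (Z w, ?V w)) = ?R \<Otimes>\<^sub>M gauss v"
      using ind unfolding indep_var_distribution_eq law by simp
    also have "(\<integral>\<^sup>+p. indicator A (c *\<^sub>R fst p + snd p, fst p) \<partial>(?R \<Otimes>\<^sub>M gauss v))
        = (\<integral>\<^sup>+z. (\<integral>\<^sup>+u. indicator A (c *\<^sub>R z + u, z) \<partial>gauss v) \<partial>?R)"
      by (subst G.nn_integral_fst[symmetric]) auto
    also have "\<dots> = (\<integral>\<^sup>+z. (\<integral>\<^sup>+x. indicator A (x, z) \<partial>source c v z) \<partial>?R)"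
      unfolding source_def by (subst nn_integral_distr) auto
    also have "\<dots> = emeasure (?R \<bind> (\<lambda>z. source c v z \<bind> (\<lambda>x. return (borel \<Otimes>\<^sub>M borel) (x, z)))) A"
    proof -
      have "emeasure (source c v z \<bind> (\<lambda>x. return (borel \<Otimes>\<^sub>M borel) (x, z))) A = (\<integral>\<^sup>+x. indicator A (x, z) \<partial>source c v z)" for z
        using measurable_space[OF src, of z] A by (subst emeasure_bind_prob_algebra[where N = borel and L = "borel \<Otimes>\<^sub>M borel"]) auto
      then show ?thesis by (simp add: emeasure_bind_prob_algebra[OF R k A])
    qed
    finally show "emeasure ?L A = emeasure (?R \<bind> (\<lambda>z. source c v z \<bind> (\<lambda>x. return (borel \<Otimes>\<^sub>M borel) (x, z)))) A" .
  qed
  have gs: "gaussian_source ?R v K" if "K \<in> borel \<Otimes>\<^sub>M borel \<rightarrow>\<^sub>M prob_algebra borel" for K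
    using R v that by unfold_locales
  have q: "quantizer_law ?L K = joint_law ?R (source c v) K"
    if "K \<in> borel \<Otimes>\<^sub>M borel \<rightarrow>\<^sub>M prob_algebra borel" for K
    unfolding L by (rule quantizer_law_eq_joint_law) (use R src that in unfold_locales)
  define I where "I K = cond_mutual_info 2 (quantizer_law ?L K)
     borel borel borel (\<lambda>(x, y, z). x) (\<lambda>(x, y, z). y) (\<lambda>(x, y, z). z)" for K
  define F where "F = {K \<in> borel \<Otimes>\<^sub>M borel \<rightarrow>\<^sub>M prob_algebra borel.
    (\<integral>\<^sup>+(x, y, z). ennreal ((norm (x - y))\<^sup>2) \<partial>quantizer_law ?L K) \<le> ennreal (DIM('a) / 2 * d)}"
  have rate: "min_feedback_rate M X Z (DIM('a) / 2 * d) = (INF K\<in>F. I K)"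
    by (simp add: min_feedback_rate_def F_def I_def)
  show ?thesis
    unfolding rate
  proof (rule antisym)
    show "ereal (DIM('a) / 2 * max (log 2 (v / d)) 0) \<le> (INF K\<in>F. I K)"
    proof (rule INF_greatest)
      fix K assume "K \<in> F"
      then have K: "K \<in> borel \<Otimes>\<^sub>M borel \<rightarrow>\<^sub>M prob_algebra borel"
        and dist: "(\<integral>\<^sup>+(x, y, z). ennreal ((norm (x - y))\<^sup>2) \<partial>joint_law ?R (source c v) K) \<le> ennreal (DIM('a) / 2 * d)"
        using q by (auto simp: F_def)
      interpret gaussian_source ?R c v K by (rule gs[OF K])
      show "ereal (DIM('a) / 2 * max (log 2 (v / d)) 0) \<le> I K"
        unfolding I_def q[OF K] cond_mutual_info_T by (rule KL_ge[OF d dist])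
    qed
    have "\<exists>K\<in>F. I K = ereal (DIM('a) / 2 * max (log 2 (v / d)) 0)"
    proof (cases "d < v")
      case True
      interpret gaussian_test_channel ?R c v d using R d True by unfold_locales
      show ?thesis
      proof (rule bexI)
        show "I (test_channel c v d) = ereal (DIM('a) / 2 * max (log 2 (v / d)) 0)"
          unfolding I_def q[OF K] cond_mutual_info_T KL_test_channel using True d by (simp add: max_def)
        show "test_channel c v d \<in> F"
          unfolding F_def using distortion_T q[OF K] K by simp
      qed
    next
      case False
      let ?K = "\<lambda>(x :: 'a, z :: 'a). return borel (c *\<^sub>R z)"
      have K: "?K \<in> borel \<Otimes>\<^sub>M borel \<rightarrow>\<^sub>M prob_algebra borel" by measurable
      interpret gaussian_source ?R c v ?K by (rule gs[OF K])
      show ?thesis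
      proof (rule bexI)
        show "I ?K = ereal (DIM('a) / 2 * max (log 2 (v / d)) 0)"
          unfolding I_def q[OF K] cond_mutual_info_T distortion_const(2)[OF refl]
          using False d v by (simp add: max_def log_le_zero_cancel_iff)
        show "?K \<in> F"
          unfolding F_def using distortion_const(1)[OF refl] False q[OF K] K by (simp add: ennreal_leI)
      qed
    qed
    then show "(INF K\<in>F. I K) \<le> ereal (DIM('a) / 2 * max (log 2 (v / d)) 0)"
      by (metis INF_lower)
  qed
qed

section \<open>The feedback rate\<close>

theorem mainTheorem1:
  fixes M :: "'w measure"
    and H0 H1 Hhat0 Hhat1 Hbar0 E0 Psi0 W1 He0 He1 :: "'w \<Rightarrow> complex ^ 't::finite ^ 'r::finite"
    and f\<^sub>d \<tau> \<alpha> \<sigma>\<^sub>h \<sigma>\<^sub>h\<^sub>h\<^sub>a\<^sub>t D d :: real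
  assumes "prob_space M"
    and alpha: "\<alpha> = bessel_J0 (2 * pi * f\<^sub>d * \<tau>)"
    and sigma: "\<sigma>\<^sub>h\<^sub>h\<^sub>a\<^sub>t\<^sup>2 \<ge> \<sigma>\<^sub>h\<^sup>2" "\<sigma>\<^sub>h\<^sup>2 > 0"
    and distortion: "D > 0" "d = D / (real CARD('r) * real CARD('t))"
    \<comment> \<open>time-correlated channel; the indices 0 and 1 stand for the blocks n - 1 and n\<close>
    and channel: "\<And>w. w \<in> space M \<Longrightarrow> H1 w = \<alpha> *\<^sub>R H0 w + sqrt (1 - \<alpha>\<^sup>2) *\<^sub>R W1 w"
      "iid_complex_normal M (\<sigma>\<^sub>h\<^sup>2) H0" "iid_complex_normal M (\<sigma>\<^sub>h\<^sup>2) W1"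
      "prob_space.indep_var M borel W1 borel H0"
    \<comment> \<open>channel estimation\<close>
    and estimation0: "\<And>w. w \<in> space M \<Longrightarrow> Hhat0 w = H0 w + He0 w"
      "iid_complex_normal M (\<sigma>\<^sub>h\<^sub>h\<^sub>a\<^sub>t\<^sup>2 - \<sigma>\<^sub>h\<^sup>2) He0"
      "prob_space.indep_var M borel He0 borel H0"
    and estimation1: "\<And>w. w \<in> space M \<Longrightarrow> Hhat1 w = H1 w + He1 w"
      "iid_complex_normal M (\<sigma>\<^sub>h\<^sub>h\<^sub>a\<^sub>t\<^sup>2 - \<sigma>\<^sub>h\<^sup>2) He1"
      "prob_space.indep_var M borel He1 borel H1"
    and Psi: "\<And>w. w \<in> space M \<Longrightarrow> Psi0 w = H0 w - (\<sigma>\<^sub>h\<^sup>2 / \<sigma>\<^sub>h\<^sub>h\<^sub>a\<^sub>t\<^sup>2) *\<^sub>R Hhat0 w"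
    \<comment> \<open>quantization in the previous block\<close>
    and quantization: "\<And>w. w \<in> space M \<Longrightarrow> Hhat0 w = Hbar0 w + E0 w"
      "\<exists>v\<ge>0. iid_complex_normal M v Hbar0" "iid_complex_normal M d E0"
      "prob_space.indep_var M borel E0 borel Hbar0"
    and independence:
      "prob_space.indep_vars M (\<lambda>_. borel) (\<lambda>k. [Hbar0, E0, Psi0, W1, He1] ! k) {..<5}"
  shows "min_feedback_rate M Hhat1 Hbar0 D =
    ereal (real CARD('r) * real CARD('t) *
      max (log 2 (\<alpha>\<^sup>2 * (\<sigma>\<^sub>h\<^sup>2 / \<sigma>\<^sub>h\<^sub>h\<^sub>a\<^sub>t\<^sup>2)\<^sup>2 + (1 - \<alpha>\<^sup>2) / d * \<sigma>\<^sub>h\<^sup>2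
             + (\<sigma>\<^sub>h\<^sub>h\<^sub>a\<^sub>t\<^sup>2 - \<sigma>\<^sub>h\<^sup>2) / d * (1 + \<alpha>\<^sup>2 * (\<sigma>\<^sub>h\<^sup>2 / \<sigma>\<^sub>h\<^sub>h\<^sub>a\<^sub>t\<^sup>2)))) 0)"
proof -
  interpret prob_space M by fact
  let ?X = "\<lambda>k. [Hbar0, E0, Psi0, W1, He1] ! k"
  have "?X k \<in> borel_measurable M" if "k < 5" for k
    using independence that by (auto simp: indep_vars_def)
  from this[of 0] this[of 1] this[of 2] this[of 3] this[of 4]
  have [measurable]: "Hbar0 \<in> borel_measurable M" "E0 \<in> borel_measurable M" "Psi0 \<in> borel_measurable M"
    "W1 \<in> borel_measurable M" "He1 \<in> borel_measurable M"
    by simp_all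
  have [measurable]: "H0 \<in> borel_measurable M" "He0 \<in> borel_measurable M"
    using estimation0(3) indep_var_rv1 indep_var_rv2 by blast+
  \<comment> \<open>\<rho> is the coefficient of the linear mean-square estimate of the channel from
    its noisy observation; \<open>q\<close> is the variance of the estimation noise.\<close>
  define \<rho> where "\<rho> = \<sigma>\<^sub>h\<^sup>2 / \<sigma>\<^sub>h\<^sub>h\<^sub>a\<^sub>t\<^sup>2"
  define q where "q = \<sigma>\<^sub>h\<^sub>h\<^sub>a\<^sub>t\<^sup>2 - \<sigma>\<^sub>h\<^sup>2"
  have q: "q \<ge> 0" using sigma by (simp add: q_def)
  have shat: "\<sigma>\<^sub>h\<^sub>h\<^sub>a\<^sub>t\<^sup>2 > 0" using sigma by linarith
  have \<rho>: "\<rho> > 0" unfolding \<rho>_def using sigma(2) shat by (rule divide_pos_pos)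
  have d: "d > 0" using distortion by simp
  \<comment> \<open>The one property of the Bessel function that enters: it makes
    \<open>1 - \<alpha>\<^sup>2\<close> the square of
    \<open>sqrt (1 - \<alpha>\<^sup>2)\<close>.\<close>
  have "\<bar>\<alpha>\<bar> \<le> 1" unfolding alpha by (rule abs_bessel_J0_le_1)
  hence \<alpha>: "\<alpha>\<^sup>2 \<le> 1" by (simp add: abs_square_le_1)
  define \<psi> where "\<psi> = \<rho> * q"

  have scaled: "distr M borel (\<lambda>w. r *\<^sub>R A w) = gauss (r\<^sup>2 * u)"
    if "distr M borel A = gauss u" "u \<ge> 0" and [measurable]: "A \<in> borel_measurable M"
    for A :: "'w \<Rightarrow> complex ^ 't ^ 'r" and r u
    using gauss_scale[OF that(2), of r, where 'a = "complex ^ 't ^ 'r"]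
    unfolding that(1)[symmetric] by (subst (asm) distr_distr) (auto simp: comp_def)
  have H0: "distr M borel H0 = gauss (\<sigma>\<^sub>h\<^sup>2)" and He0: "distr M borel He0 = gauss q"
    using channel(2) estimation0(2) sigma unfolding q_def by (auto intro!: distr_iid_complex_normal)
  \<comment> \<open>Eliminating \<open>Hhat0\<close> writes \<open>Psi0\<close> as a combination of
    the independent \<open>H0\<close> and \<open>He0\<close>; its variance then follows from the
    model and equals \<rho> q.\<close>
  have "distr M borel Psi0 = distr M borel (\<lambda>w. - \<rho> *\<^sub>R He0 w + (1 - \<rho>) *\<^sub>R H0 w)"
    by (intro distr_cong) (auto simp: Psi estimation0(1) \<rho>_def algebra_simps)
  also have "\<dots> = gauss ((- \<rho>)\<^sup>2 * q + (1 - \<rho>)\<^sup>2 * \<sigma>\<^sub>h\<^sup>2)"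
  proof (rule distr_add_gauss)
    show "indep_var borel (\<lambda>w. - \<rho> *\<^sub>R He0 w) borel (\<lambda>w. (1 - \<rho>) *\<^sub>R H0 w)"
      using indep_var_compose[OF estimation0(3), of "\<lambda>x. - \<rho> *\<^sub>R x" borel "\<lambda>x. (1 - \<rho>) *\<^sub>R x" borel]
      by (simp add: comp_def)
    show "distr M borel (\<lambda>w. - \<rho> *\<^sub>R He0 w) = gauss ((- \<rho>)\<^sup>2 * q)"
      by (rule scaled[OF He0 q]) simp
    show "distr M borel (\<lambda>w. (1 - \<rho>) *\<^sub>R H0 w) = gauss ((1 - \<rho>)\<^sup>2 * \<sigma>\<^sub>h\<^sup>2)"
      by (rule scaled[OF H0]) simp_all
  qed (use q in simp_all)
  also have "(- \<rho>)\<^sup>2 * q + (1 - \<rho>)\<^sup>2 * \<sigma>\<^sub>h\<^sup>2 = \<psi>"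
  proof -
    have h_eq: "\<sigma>\<^sub>h\<^sup>2 = \<rho> * \<sigma>\<^sub>h\<^sub>h\<^sub>a\<^sub>t\<^sup>2" and q_eq: "q = (1 - \<rho>) * \<sigma>\<^sub>h\<^sub>h\<^sub>a\<^sub>t\<^sup>2"
      using shat by (auto simp: \<rho>_def q_def left_diff_distrib)
    show ?thesis unfolding \<psi>_def h_eq q_eq by algebra
  qed
  finally have Psi0: "distr M borel Psi0 = gauss \<psi>" .
  have \<psi>: "\<psi> \<ge> 0" using q \<rho> by (simp add: \<psi>_def)

  \<comment> \<open>Positions follow the list in \<open>independence\<close>: position 0 belongs to
    the side information \<open>Hbar0\<close>, and positions 1 to 4 carry the variances and
    coefficients of the innovation.\<close>
  define u where "u k = [0, d, \<psi>, \<sigma>\<^sub>h\<^sup>2, q] ! k" for k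
  define r where "r k = [0, \<alpha> * \<rho>, \<alpha>, sqrt (1 - \<alpha>\<^sup>2), 1] ! k" for k
  define V where "V w = (\<Sum>k\<in>{1, 2, 3, 4}. r k *\<^sub>R ?X k w)" for w
  define v where "v = (\<Sum>k\<in>{1, 2, 3, 4 :: nat}. (r k)\<^sup>2 * u k)"
  have V: "distr M borel V = gauss v"
    unfolding V_def[abs_def] v_def
  proof (rule distr_scaled_sum_gauss)
    show "indep_vars (\<lambda>_. borel) ?X {1, 2, 3, 4}"
      using independence by (rule indep_vars_subset) auto
    have "distr M borel E0 = gauss d" "distr M borel W1 = gauss (\<sigma>\<^sub>h\<^sup>2)" "distr M borel He1 = gauss q"
      using quantization(3) channel(3) estimation1(2) sigma d unfolding q_def by (auto intro!: distr_iid_complex_normal)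
    then show "distr M borel (?X k) = gauss (u k)" if "k \<in> {1, 2, 3, 4}" for k
      using that Psi0 by (auto simp: u_def)
    show "u k \<ge> 0" if "k \<in> {1, 2, 3, 4}" for k
      using that d \<psi> q by (auto simp: u_def)
  qed simp
  have v_eq: "v = (\<alpha> * \<rho>)\<^sup>2 * d + \<alpha>\<^sup>2 * \<psi> + (1 - \<alpha>\<^sup>2) * \<sigma>\<^sub>h\<^sup>2 + q"
    using \<alpha> by (simp add: v_def u_def r_def)
  \<comment> \<open>If \<alpha> is nonzero, the previous quantization error keeps v positive even
    when estimation is perfect and \<alpha> is 1 or -1; if \<alpha> = 0, the fresh channel
    does.\<close>
  have v: "v > 0"
  proof (cases "\<alpha> = 0")
    case True
    then have "v = \<sigma>\<^sub>h\<^sup>2 + q" by (simp add: v_eq)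
    then show ?thesis using sigma q by linarith
  next
    case False
    then have "(\<alpha> * \<rho>)\<^sup>2 * d > 0" using \<rho> d by simp
    moreover have "\<alpha>\<^sup>2 * \<psi> \<ge> 0" "(1 - \<alpha>\<^sup>2) * \<sigma>\<^sub>h\<^sup>2 \<ge> 0" using \<psi> \<alpha> by auto
    ultimately show ?thesis using q by (simp add: v_eq)
  qed
  have ind: "indep_var borel Hbar0 borel V"
  proof -
    have "{..<5} = insert 0 {1, 2, 3, 4 :: nat}" by auto
    then have "indep_var borel (\<lambda>w. 1 *\<^sub>R ?X 0 w) borel (\<lambda>w. \<Sum>k\<in>{1, 2, 3, 4}. r k *\<^sub>R ?X k w)"
      using independence by (intro indep_var_scaled_sum) auto
    then show ?thesis by (simp add: V_def[abs_def])
  qed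
  have [measurable]: "V \<in> borel_measurable M" using ind by (rule indep_var_rv2)
  let ?X1 = "\<lambda>w. (\<alpha> * \<rho>) *\<^sub>R Hbar0 w + V w"
  have X1: "Hhat1 w = ?X1 w" if "w \<in> space M" for w
  proof -
    \<comment> \<open>Inverting the definition of \<open>Psi0\<close> expresses the old channel
      through the quantized estimate.\<close>
    have "H0 w = Psi0 w + \<rho> *\<^sub>R (Hbar0 w + E0 w)"
      using Psi[OF that] quantization(1)[OF that] by (simp add: \<rho>_def)
    then show ?thesis
      using estimation1(1)[OF that] channel(1)[OF that] by (simp add: V_def r_def algebra_simps)
  qed
  \<comment> \<open>The representation holds on \<open>space M\<close> only, which is enough because
    the rate depends on the pair through its joint law.\<close>
  have "min_feedback_rate M Hhat1 Hbar0 D = min_feedback_rate M ?X1 Hbar0 D"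
  proof -
    have "distr M (borel \<Otimes>\<^sub>M borel) (\<lambda>w. (Hhat1 w, Hbar0 w)) = distr M (borel \<Otimes>\<^sub>M borel) (\<lambda>w. (?X1 w, Hbar0 w))"
      by (intro distr_cong) (auto simp: X1)
    then show ?thesis unfolding min_feedback_rate_def by simp
  qed
  also have "min_feedback_rate M ?X1 Hbar0 D = ereal (DIM(complex ^ 't ^ 'r) / 2 * max (log 2 (v / d)) 0)"
  proof -
    \<comment> \<open>The real dimension of the matrix space is twice the number of entries, so this
      recovers D from its share d per entry.\<close>
    have D: "D = DIM(complex ^ 't ^ 'r) / 2 * d" using distortion by simp
    show ?thesis
      unfolding D using ind V v d \<open>prob_space M\<close>
      by (intro min_feedback_rate_gaussian[where c = "\<alpha> * \<rho>"]) auto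
  qed
  \<comment> \<open>Substituting \<psi> = \<rho> q merges the contributions of \<open>Psi0\<close>
    and \<open>He1\<close> into the last summand.\<close>
  also have "v / d = \<alpha>\<^sup>2 * \<rho>\<^sup>2 + (1 - \<alpha>\<^sup>2) / d * \<sigma>\<^sub>h\<^sup>2 + q / d * (1 + \<alpha>\<^sup>2 * \<rho>)"
    using d by (simp add: v_eq \<psi>_def add_divide_distrib distrib_left power_mult_distrib mult_ac)
  finally show ?thesis by (simp add: \<rho>_def q_def)
qed

end
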